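(* Let $G$ be a finitely generated group and $H$ an infinite subgroup of $G$. Then $H$ is strongly quasiconvex in $G$ if and only if the lower relative divergence of $G$ with respect to $H$ is completely super linear.
   Context: A $(K,L)$-quasi-geodesic is a map $c$ from an interval of $\mathbb{R}$ to a metric space with $\frac1K|s-t|-L\le d(c(s),c(t))\le K|s-t|+L$. A subgroup $H\le G$ is strongly quasiconvex if, in the Cayley graph of $G$ for some (any) finite generating set, for every $K\ge1$, $C\ge0$ there is $M=M(K,C)$ such that every $(K,C)$-quasi-geodesic with endpoints on $H$ lies in the $M$-neighborhood of $H$. Lower relative divergence: let $X$ be a geodesic space and $A\subset X$ of infinite diameter. Put $N_r(A)=\{x: d(x,A)<r\}$, $\partial N_r(A)=\{x: d(x,A)=r\}$, $C_r(A)=X-N_r(A)$, and let $d_r$ be the induced length metric on $C_r(A)$ (value $\infty$ if there is no connecting rectifiable path). For $\rho\in(0,1]$ and integer $n\ge2$ define $\sigma^n_\rho(r)\in[0,\infty]$ for $r>0$ by $\sigma^n_\rho(r)=\inf d_{\rho r}(x_1,x_2)$ over all $x_1,x_2\in\partial N_r(A)$ with $d_r(x_1,x_2)<\infty$ and $d(x_1,x_2)\ge nr$, and $\sigma^n_\rho(r)=\infty$ if no such pair exists. The family $\{\sigma^n_\rho\}$ is the lower relative divergence $div(X,A)$. For a finitely generated group $G$ and a subgroup $H$ (not assumed finitely generated), $div(G,H)$ is the lower relative divergence of a Cayley graph of $G$ (finite generating set) with respect to $H$. A function $f:[0,\infty)\to[0,\infty]$ is completely super linear if for every $C>0$ the set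 $\{x: f(x)\le Cx\}$ is bounded. A family $\{\delta^n_\rho\}$ ($\rho\in(0,1]$, $n\ge2$) is completely super linear if there is $n_0\ge3$ such that $\delta^{n_0}_\rho$ is completely super linear for all $\rho\in(0,1]$. *)

theory Defs
  imports "HOL-Analysis.Analysis" "HOL-Algebra.Generated_Groups"
begin

section \<open>Metric notions\<close>

definition quasi_geodesic :: "'a metric \<Rightarrow> real \<Rightarrow> real \<Rightarrow> real set \<Rightarrow> (real \<Rightarrow> 'a) \<Rightarrow> bool" where
  "quasi_geodesic X K L I c \<longleftrightarrow>
     is_interval I \<and> c ` I \<subseteq> mspace X \<and>
     (\<forall>s\<in>I. \<forall>t\<in>I. 1 / K * \<bar>s - t\<bar> - L \<le> mdist X (c s) (c t) \<and>
                  mdist X (c s) (c t) \<le> K * \<bar>s - t\<bar> + L)"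

text \<open>Only meaningful for nonempty \<open>A\<close>.\<close>

definition dist_to :: "'a metric \<Rightarrow> 'a set \<Rightarrow> 'a \<Rightarrow> real" where
  "dist_to X A x = (INF a\<in>A. mdist X x a)"

definition nbhd :: "'a metric \<Rightarrow> 'a set \<Rightarrow> real \<Rightarrow> 'a set" where
  "nbhd X A r = {x \<in> mspace X. dist_to X A x < r}"

definition nbhd_boundary :: "'a metric \<Rightarrow> 'a set \<Rightarrow> real \<Rightarrow> 'a set" where
  "nbhd_boundary X A r = {x \<in> mspace X. dist_to X A x = r}"

definition nbhd_compl :: "'a metric \<Rightarrow> 'a set \<Rightarrow> real \<Rightarrow> 'a set" where
  "nbhd_compl X A r = mspace X - nbhd X A r"

definition curve_length :: "'a metric \<Rightarrow> (real \<Rightarrow> 'a) \<Rightarrow> ennreal" where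
  "curve_length X p =
     (SUP (n, t) \<in> {(n :: nat, t :: nat \<Rightarrow> real). mono_on {..n} t \<and> t ` {..n} \<subseteq> {0..1}}.
        ennreal (\<Sum>i<n. mdist X (p (t i)) (p (t (Suc i)))))"

text \<open>
  Non-rectifiable paths have length \<open>\<infinity>\<close>, and the infimum of the empty set is \<open>\<infinity>\<close>, so the
  value is \<open>\<infinity>\<close> exactly when no rectifiable path in \<open>C\<close> joins the two points.
\<close>

definition induced_length_dist :: "'a metric \<Rightarrow> 'a set \<Rightarrow> 'a \<Rightarrow> 'a \<Rightarrow> ennreal" where
  "induced_length_dist X C x y =
     (INF p \<in> {p. pathin (subtopology (mtopology_of X) C) p \<and> p 0 = x \<and> p 1 = y}.
        curve_length X p)"

section \<open>Lower relative divergence\<close>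

text \<open>The arguments are, in order, \<open>X\<close>, \<open>A\<close>, \<open>n\<close>, \<open>\<rho>\<close>, \<open>r\<close>.  Only \<open>r > 0\<close> is meaningful; the
  value at \<open>r \<le> 0\<close> does not influence complete super linearity.\<close>

definition lower_rel_div :: "'a metric \<Rightarrow> 'a set \<Rightarrow> nat \<Rightarrow> real \<Rightarrow> real \<Rightarrow> ennreal" where
  "lower_rel_div X A n \<rho> r =
     (INF (x1, x2) \<in> {(x1, x2). x1 \<in> nbhd_boundary X A r \<and> x2 \<in> nbhd_boundary X A r \<and>
                        induced_length_dist X (nbhd_compl X A r) x1 x2 < \<infinity> \<and>
                        mdist X x1 x2 \<ge> real n * r}.
        induced_length_dist X (nbhd_compl X A (\<rho> * r)) x1 x2)"

definition completely_super_linear :: "(real \<Rightarrow> ennreal) \<Rightarrow> bool" where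
  "completely_super_linear f \<longleftrightarrow> (\<forall>C>0. bounded {x. 0 \<le> x \<and> f x \<le> ennreal (C * x)})"

definition completely_super_linear_family :: "(nat \<Rightarrow> real \<Rightarrow> real \<Rightarrow> ennreal) \<Rightarrow> bool" where
  "completely_super_linear_family \<delta> \<longleftrightarrow>
     (\<exists>n0\<ge>3. \<forall>\<rho>. 0 < \<rho> \<and> \<rho> \<le> 1 \<longrightarrow> completely_super_linear (\<delta> n0 \<rho>))"

section \<open>Geometric realization of a graph\<close>

text \<open>
  Points are given by barycentric coordinates: \<open>edge_point u v t\<close> is the point at distance \<open>t\<close>
  from \<open>u\<close> on an edge of length 1 from \<open>u\<close> to \<open>v\<close>.
\<close>

definition edge_point :: "'a \<Rightarrow> 'a \<Rightarrow> real \<Rightarrow> 'a \<Rightarrow> real" where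
  "edge_point u v t = (\<lambda>w. (1 - t) * of_bool (w = u) + t * of_bool (w = v))"

definition vertex :: "'a \<Rightarrow> 'a \<Rightarrow> real" where
  "vertex u = (\<lambda>w. of_bool (w = u))"

definition graph_points :: "'a set \<Rightarrow> ('a \<Rightarrow> 'a \<Rightarrow> bool) \<Rightarrow> ('a \<Rightarrow> real) set" where
  "graph_points V E = vertex ` V \<union> {edge_point u v t | u v t. E u v \<and> 0 \<le> t \<and> t \<le> 1}"

text \<open>
  \<open>graph_chain V E x y l\<close>: some finite sequence of points from \<open>x\<close> to \<open>y\<close>, consecutive ones
  lying on a common edge, has total length \<open>l\<close>.  The metric is the infimum of such lengths, i.e.
  the path metric in which every edge is an interval of length 1.
\<close>

inductive graph_chain :: "'a set \<Rightarrow> ('a \<Rightarrow> 'a \<Rightarrow> bool) \<Rightarrow>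
    ('a \<Rightarrow> real) \<Rightarrow> ('a \<Rightarrow> real) \<Rightarrow> real \<Rightarrow> bool" for V E where
  refl: "x \<in> graph_points V E \<Longrightarrow> graph_chain V E x x 0"
| step: "\<lbrakk>E u v; 0 \<le> s; s \<le> 1; 0 \<le> t; t \<le> 1; graph_chain V E (edge_point u v t) y l\<rbrakk>
         \<Longrightarrow> graph_chain V E (edge_point u v s) y (\<bar>s - t\<bar> + l)"

definition graph_dist :: "'a set \<Rightarrow> ('a \<Rightarrow> 'a \<Rightarrow> bool) \<Rightarrow> ('a \<Rightarrow> real) \<Rightarrow> ('a \<Rightarrow> real) \<Rightarrow> real" where
  "graph_dist V E x y = Inf {l. graph_chain V E x y l}"

lemma edge_point_0 [simp]: "edge_point u v 0 = vertex u"
  and edge_point_1 [simp]: "edge_point u v 1 = vertex v"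
  by (auto simp: edge_point_def vertex_def)

lemma graph_chain_points:
  "graph_chain V E x y l \<Longrightarrow> x \<in> graph_points V E \<and> y \<in> graph_points V E"
  by (induction rule: graph_chain.induct) (auto simp: graph_points_def)

lemma graph_chain_trans:
  "graph_chain V E x y l \<Longrightarrow> graph_chain V E y z m \<Longrightarrow> graph_chain V E x z (l + m)"
  by (induction rule: graph_chain.induct) (auto simp: add.assoc intro: graph_chain.step)

lemma graph_chain_step1:
  assumes "E u v" "0 \<le> s" "s \<le> 1" "0 \<le> t" "t \<le> 1"
  shows "graph_chain V E (edge_point u v s) (edge_point u v t) \<bar>s - t\<bar>"
proof -
  have "edge_point u v t \<in> graph_points V E"
    using assms by (auto simp: graph_points_def)
  from graph_chain.step[OF assms graph_chain.refl[OF this]] show ?thesis by simp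
qed

lemma graph_chain_sym: "graph_chain V E x y l \<Longrightarrow> graph_chain V E y x l"
proof (induction rule: graph_chain.induct)
  case (refl x)
  then show ?case by (rule graph_chain.refl)
next
  case (step u v s t y l)
  have "graph_chain V E (edge_point u v t) (edge_point u v s) \<bar>t - s\<bar>"
    using step by (intro graph_chain_step1)
  from graph_chain_trans[OF step.IH this] show ?case
    by (simp add: abs_minus_commute add.commute)
qed

lemma edge_point_lipschitz: "\<bar>edge_point u v s w - edge_point u v t w\<bar> \<le> \<bar>s - t\<bar>"
  by (auto simp: edge_point_def)

lemma graph_chain_lower: "graph_chain V E x y l \<Longrightarrow> \<bar>x w - y w\<bar> \<le> l"
proof (induction rule: graph_chain.induct)
  case (step u v s t y l)
  then show ?case using edge_point_lipschitz[of u v s w t] by linarith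
qed auto

lemma graph_chain_to_vertex:
  assumes "x \<in> graph_points V E" "\<And>u v. E u v \<Longrightarrow> u \<in> V"
  shows "\<exists>u\<in>V. \<exists>l. graph_chain V E x (vertex u) l"
proof -
  consider u where "u \<in> V" "x = vertex u"
    | u v t where "E u v" "0 \<le> t" "t \<le> 1" "x = edge_point u v t"
    using assms(1) by (auto simp: graph_points_def)
  then show ?thesis
  proof cases
    case 1
    then show ?thesis using graph_chain.refl[of x V E] assms(1) by blast
  next
    case 2
    then show ?thesis using graph_chain_step1[of E u v t 0 V] assms(2) by auto
  qed
qed

lemma Metric_space_graph:
  assumes E: "\<And>u v. E u v \<Longrightarrow> u \<in> V"
    and conn: "\<And>u v. u \<in> V \<Longrightarrow> v \<in> V \<Longrightarrow> \<exists>l. graph_chain V E (vertex u) (vertex v) l"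
  shows "Metric_space (graph_points V E)
           (\<lambda>x y. if x \<in> graph_points V E \<and> y \<in> graph_points V E then graph_dist V E x y else 0)"
proof -
  let ?P = "graph_points V E" and ?C = "graph_chain V E"
  have ex: "{l. ?C x y l} \<noteq> {}" if xy: "x \<in> ?P" "y \<in> ?P" for x y
  proof -
    obtain u k where u: "u \<in> V" "?C x (vertex u) k"
      using graph_chain_to_vertex[OF xy(1)] E by blast
    obtain v m where v: "v \<in> V" "?C y (vertex v) m"
      using graph_chain_to_vertex[OF xy(2)] E by blast
    obtain l where "?C (vertex u) (vertex v) l" using conn u v by blast
    then show ?thesis
      using graph_chain_trans[OF graph_chain_trans[OF u(2)] graph_chain_sym[OF v(2)]] by blast
  qed
  have ge0: "0 \<le> l" if "?C x y l" for x y l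
    using graph_chain_lower[OF that, of undefined] by linarith
  have bdd: "bdd_below {l. ?C x y l}" for x y
    using ge0 by (intro bdd_belowI[of _ 0]) auto
  have sym: "graph_dist V E x y = graph_dist V E y x" for x y
    unfolding graph_dist_def by (rule arg_cong[of _ _ Inf]) (auto intro: graph_chain_sym)
  have nn: "0 \<le> graph_dist V E x y" if "x \<in> ?P" "y \<in> ?P" for x y
    unfolding graph_dist_def using ge0 ex[OF that] by (intro cInf_greatest) auto
  have self: "graph_dist V E x x = 0" if "x \<in> ?P" for x
  proof -
    have "graph_dist V E x x \<le> 0"
      unfolding graph_dist_def
      by (rule cInf_lower) (use that bdd in \<open>auto intro: graph_chain.refl\<close>)
    with nn[OF that that] show ?thesis by simp
  qed
  have pos: "x = y" if xy: "x \<in> ?P" "y \<in> ?P" and z: "graph_dist V E x y = 0" for x y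
  proof
    fix w
    have "\<bar>x w - y w\<bar> \<le> graph_dist V E x y"
      unfolding graph_dist_def using graph_chain_lower ex[OF xy]
      by (intro cInf_greatest) auto
    with z show "x w = y w" by simp
  qed
  have tri: "graph_dist V E x z \<le> graph_dist V E x y + graph_dist V E y z"
    if xyz: "x \<in> ?P" "y \<in> ?P" "z \<in> ?P" for x y z
  proof (rule field_le_epsilon)
    fix e :: real assume "e > 0"
    then have lt: "Inf {l. ?C x y l} < graph_dist V E x y + e / 2"
      and lt2: "Inf {l. ?C y z l} < graph_dist V E y z + e / 2"
      by (auto simp: graph_dist_def)
    obtain l where l: "?C x y l" "l < graph_dist V E x y + e / 2"
      using cInf_lessD[OF ex[OF xyz(1,2)] lt] by blast
    obtain m where m: "?C y z m" "m < graph_dist V E y z + e / 2"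
      using cInf_lessD[OF ex[OF xyz(2,3)] lt2] by blast
    have "graph_dist V E x z \<le> l + m"
      unfolding graph_dist_def
      using graph_chain_trans[OF l(1) m(1)] bdd by (intro cInf_lower) auto
    with l m show "graph_dist V E x z \<le> graph_dist V E x y + graph_dist V E y z + e"
      by linarith
  qed
  show ?thesis
  proof
    fix x y z
    let ?d = "\<lambda>x y. if x \<in> ?P \<and> y \<in> ?P then graph_dist V E x y else 0"
    show "0 \<le> ?d x y" using nn by auto
    show "?d x y = ?d y x" using sym[of x y] by auto
    show "?d x y = 0 \<longleftrightarrow> x = y" if "x \<in> ?P" "y \<in> ?P"
      using that self pos by auto
    show "?d x z \<le> ?d x y + ?d y z" if "x \<in> ?P" "y \<in> ?P" "z \<in> ?P"
      using that tri by auto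
  qed
qed

section \<open>Cayley graphs\<close>

definition finite_generating_set :: "('a, 'b) monoid_scheme \<Rightarrow> 'a set \<Rightarrow> bool" where
  "finite_generating_set G S \<longleftrightarrow> finite S \<and> S \<subseteq> carrier G \<and> generate G S = carrier G"

text \<open>The edges join \<open>g\<close> and \<open>gs\<close> for \<open>s \<in> S\<close>; loops and multiple edges are dropped.\<close>

definition cayley_edge :: "('a, 'b) monoid_scheme \<Rightarrow> 'a set \<Rightarrow> 'a \<Rightarrow> 'a \<Rightarrow> bool" where
  "cayley_edge G S g h \<longleftrightarrow>
     g \<in> carrier G \<and> h \<in> carrier G \<and> g \<noteq> h \<and> (\<exists>s\<in>S. h = g \<otimes>\<^bsub>G\<^esub> s \<or> g = h \<otimes>\<^bsub>G\<^esub> s)"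

text \<open>The distance is set to 0 off the space because \<open>Metric_space\<close> constrains it there too.\<close>

definition cayley_graph :: "('a, 'b) monoid_scheme \<Rightarrow> 'a set \<Rightarrow> ('a \<Rightarrow> real) metric" where
  "cayley_graph G S =
     (let P = graph_points (carrier G) (cayley_edge G S)
      in metric (P, \<lambda>x y. if x \<in> P \<and> y \<in> P
                          then graph_dist (carrier G) (cayley_edge G S) x y else 0))"

lemma cayley_connected:
  assumes G: "group G" and S: "S \<subseteq> carrier G" and h: "h \<in> generate G S"
  shows "g \<in> carrier G \<Longrightarrow>
    \<exists>l. graph_chain (carrier G) (cayley_edge G S) (vertex g) (vertex (g \<otimes>\<^bsub>G\<^esub> h)) l"
  using h
proof (induction arbitrary: g rule: generate.induct)
  interpret group G by fact
  let ?C = "graph_chain (carrier G) (cayley_edge G S)"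
  have self: "\<exists>l. ?C (vertex g) (vertex g) l" if "g \<in> carrier G" for g
    using that by (intro exI[of _ 0] graph_chain.refl) (auto simp: graph_points_def)
  have edge: "\<exists>l. ?C (vertex g) (vertex h) l"
    if "g \<in> carrier G" "h \<in> carrier G" "s \<in> S" "h = g \<otimes>\<^bsub>G\<^esub> s \<or> g = h \<otimes>\<^bsub>G\<^esub> s" for g h s
  proof (cases "g = h")
    case False
    then have "cayley_edge G S g h" using that unfolding cayley_edge_def by blast
    from graph_chain_step1[of "cayley_edge G S" g h 0 1, OF this] show ?thesis by auto
  qed (use self that in blast)
  {
    case one
    then show ?case using self by simp
  next
    case (incl h)
    then show ?case using S by (intro edge[of _ _ h]) auto
  next
    case (inv h)
    then have "h \<in> carrier G" using S by auto
    then have "g = g \<otimes>\<^bsub>G\<^esub> inv\<^bsub>G\<^esub> h \<otimes>\<^bsub>G\<^esub> h" using inv by (simp add: m_assoc)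
    with inv \<open>h \<in> carrier G\<close> show ?case by (intro edge[of _ _ h]) auto
  next
    case (eng h1 h2)
    then have c: "h1 \<in> carrier G" "h2 \<in> carrier G"
      using S generate_in_carrier by auto
    obtain l where l: "?C (vertex g) (vertex (g \<otimes>\<^bsub>G\<^esub> h1)) l" using eng by blast
    obtain m where "?C (vertex (g \<otimes>\<^bsub>G\<^esub> h1)) (vertex (g \<otimes>\<^bsub>G\<^esub> h1 \<otimes>\<^bsub>G\<^esub> h2)) m"
      using eng.IH(2)[of "g \<otimes>\<^bsub>G\<^esub> h1"] eng.prems c by auto
    from graph_chain_trans[OF l this] show ?case using c eng.prems by (auto simp: m_assoc)
  }
qed

lemma Metric_space_cayley:
  assumes "group G" "finite_generating_set G S"
  defines "P \<equiv> graph_points (carrier G) (cayley_edge G S)"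
  shows "Metric_space P
    (\<lambda>x y. if x \<in> P \<and> y \<in> P then graph_dist (carrier G) (cayley_edge G S) x y else 0)"
  unfolding P_def
proof (rule Metric_space_graph)
  interpret group G by fact
  show "u \<in> carrier G" if "cayley_edge G S u v" for u v
    using that by (simp add: cayley_edge_def)
  fix u v assume uv: "u \<in> carrier G" "v \<in> carrier G"
  have S: "S \<subseteq> carrier G" and "inv\<^bsub>G\<^esub> u \<otimes>\<^bsub>G\<^esub> v \<in> generate G S"
    using assms uv by (auto simp: finite_generating_set_def)
  from cayley_connected[OF assms(1) this uv(1)]
  show "\<exists>l. graph_chain (carrier G) (cayley_edge G S) (vertex u) (vertex v) l"
    using uv by (simp flip: m_assoc)
qed

lemma mspace_cayley_graph:
  assumes "group G" "finite_generating_set G S"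
  shows "mspace (cayley_graph G S) = graph_points (carrier G) (cayley_edge G S)"
  using Metric_space.mspace_metric[OF Metric_space_cayley[OF assms]]
  by (simp add: cayley_graph_def Let_def)

lemma mdist_cayley_graph:
  assumes "group G" "finite_generating_set G S"
    and "x \<in> mspace (cayley_graph G S)" "y \<in> mspace (cayley_graph G S)"
  shows "mdist (cayley_graph G S) x y = graph_dist (carrier G) (cayley_edge G S) x y"
  using Metric_space.mdist_metric[OF Metric_space_cayley[OF assms(1,2)]]
    assms(3,4)[unfolded mspace_cayley_graph[OF assms(1,2)]]
  by (simp add: cayley_graph_def Let_def)

section \<open>Subgroups\<close>

definition strongly_quasiconvex :: "('a, 'b) monoid_scheme \<Rightarrow> 'a set \<Rightarrow> bool" where
  "strongly_quasiconvex G H \<longleftrightarrow>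
     (\<exists>S. finite_generating_set G S \<and>
       (\<forall>K\<ge>1. \<forall>C\<ge>0. \<exists>M. \<forall>a b c.
          a \<le> b \<and> quasi_geodesic (cayley_graph G S) K C {a..b} c \<and>
          c a \<in> vertex ` H \<and> c b \<in> vertex ` H \<longrightarrow>
          c ` {a..b} \<subseteq> nbhd (cayley_graph G S) (vertex ` H) M))"

definition group_lower_rel_div ::
    "('a, 'b) monoid_scheme \<Rightarrow> 'a set \<Rightarrow> 'a set \<Rightarrow> nat \<Rightarrow> real \<Rightarrow> real \<Rightarrow> ennreal" where
  "group_lower_rel_div G S H = lower_rel_div (cayley_graph G S) (vertex ` H)"

end

theory Submission
  imports Defs
begin

text \<open>
  Both directions are statements about a subset \<open>A\<close> of a length space \<open>X\<close>: \<open>A\<close> is a Morse subset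
  (quasi-geodesics with endpoints on \<open>A\<close> stay uniformly close to \<open>A\<close>) exactly when the lower
  divergence of \<open>X\<close> relative to \<open>A\<close> is completely super linear.

  Suppose the divergence is super linear and consider a quasi-geodesic with endpoints on \<open>A\<close> that
  reaches the maximal height \<open>R\<close> above \<open>A\<close>.  Fix a small proportion \<open>r\<close> of \<open>R\<close>, and follow the
  quasi-geodesic in both directions from its highest point, until it comes down to height about
  \<open>r\<close> or a parameter length of order \<open>R\<close> has been used up.  From the two points so obtained drop
  down to height exactly \<open>r\<close>.  The result is a curve of length \<open>O(r)\<close> avoiding the \<open>r\<close>-neighbourhood
  of \<open>A\<close>.  Its endpoints are at least \<open>n r\<close> apart: if the length was used up, because this length
  was chosen much larger than what the two drops of length at most \<open>R\<close> can compensate; otherwise,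
  because climbing from height \<open>r\<close> to \<open>R\<close> and coming back takes a length that is a large multiple
  of \<open>r\<close>.  So the divergence at \<open>r\<close> is at most a fixed multiple of \<open>r\<close>, which bounds \<open>r\<close> and hence
  \<open>R\<close>.  This is \<open>lower_rel_div_le_of_excursion\<close> and \<open>morse_subset_of_completely_super_linear\<close>.

  Conversely, suppose that there are arbitrarily large \<open>r\<close> with two points at height \<open>r\<close>, at least
  \<open>3 r\<close> apart, joined by a curve of length \<open>O(r)\<close> staying above height \<open>\<rho> r\<close>.  Prolong the curve by
  vertical descents to points of \<open>A\<close>.  Make motion below a height \<open>\<epsilon> r\<close> expensive by a large
  constant factor \<open>K\<close>.  A cheapest chain between the two points of \<open>A\<close> is then a quasi-geodesic with
  constants depending on \<open>K\<close> only, because the cost of a piece of it is at most \<open>K\<close> times the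
  distance it covers.  If \<open>A\<close> were Morse, this chain would stay at bounded height, hence would be
  expensive all along and cost at least about \<open>K r\<close>.  But the prolonged curve is expensive only on
  its two short bottom pieces of length about \<open>\<epsilon> r\<close>, so it costs less when \<open>K\<close> is large and
  \<open>\<epsilon>\<close> is small.  This is \<open>minimal_weighted_chain_quasi_geodesic\<close> and
  \<open>completely_super_linear_of_morse_subset\<close>.

  Cayley graphs are length spaces.  Being Morse is independent of the finite generating set
  because rounding to vertices is a quasi-isometry between two Cayley graphs of the same group.
\<close>

section \<open>Lipschitz curves and length spaces\<close>

text \<open>
  A curve of length at most \<open>l\<close> in \<open>C\<close>, in the form of a 1-Lipschitz curve on \<open>[0, l]\<close>; this form
  is stable under concatenation and reversal, and heights along it are easily compared.
\<close>

definition lipschitz_joined :: "'a metric \<Rightarrow> 'a set \<Rightarrow> 'a \<Rightarrow> 'a \<Rightarrow> real \<Rightarrow> bool" where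
  "lipschitz_joined X C x y l \<longleftrightarrow>
     0 \<le> l \<and> (\<exists>q. q ` {0..l} \<subseteq> C \<and> q 0 = x \<and> q l = y \<and>
       (\<forall>s\<in>{0..l}. \<forall>t\<in>{0..l}. mdist X (q s) (q t) \<le> \<bar>s - t\<bar>))"

lemma mdist_self [simp]: "x \<in> mspace X \<Longrightarrow> mdist X x x = 0"
  by (simp add: mdist_zero)

lemma lipschitz_joined_refl:
  "x \<in> C \<Longrightarrow> C \<subseteq> mspace X \<Longrightarrow> 0 \<le> l \<Longrightarrow> lipschitz_joined X C x x l"
  unfolding lipschitz_joined_def using subsetD[of C "mspace X" x]
  by (intro conjI exI[of _ "\<lambda>_. x"]) auto

lemma lipschitz_joined_sym:
  assumes "lipschitz_joined X C x y l"
  shows "lipschitz_joined X C y x l"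
proof -
  obtain q where q: "0 \<le> l" "q ` {0..l} \<subseteq> C" "q 0 = x" "q l = y"
    "\<And>s t. s \<in> {0..l} \<Longrightarrow> t \<in> {0..l} \<Longrightarrow> mdist X (q s) (q t) \<le> \<bar>s - t\<bar>"
    using assms unfolding lipschitz_joined_def by blast
  have "mdist X (q (l - s)) (q (l - t)) \<le> \<bar>s - t\<bar>" if "s \<in> {0..l}" "t \<in> {0..l}" for s t
    using q(5)[of "l - s" "l - t"] that by auto
  then show ?thesis
    unfolding lipschitz_joined_def
    using q by (intro conjI exI[of _ "\<lambda>t. q (l - t)"]) auto
qed

lemma lipschitz_joined_trans:
  assumes xy: "lipschitz_joined X C x y l" and yz: "lipschitz_joined X C y z m"
    and C: "C \<subseteq> mspace X"
  shows "lipschitz_joined X C x z (l + m)"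
proof -
  obtain p where p: "0 \<le> l" "p ` {0..l} \<subseteq> C" "p 0 = x" "p l = y"
    "\<And>s t. s \<in> {0..l} \<Longrightarrow> t \<in> {0..l} \<Longrightarrow> mdist X (p s) (p t) \<le> \<bar>s - t\<bar>"
    using xy unfolding lipschitz_joined_def by blast
  obtain q where q: "0 \<le> m" "q ` {0..m} \<subseteq> C" "q 0 = y" "q m = z"
    "\<And>s t. s \<in> {0..m} \<Longrightarrow> t \<in> {0..m} \<Longrightarrow> mdist X (q s) (q t) \<le> \<bar>s - t\<bar>"
    using yz unfolding lipschitz_joined_def by blast
  define r where "r t = (if t \<le> l then p t else q (t - l))" for t
  have r_in: "r t \<in> C" if "t \<in> {0..l + m}" for t
    using that p(2)[unfolded image_subset_iff] q(2)[unfolded image_subset_iff]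
    by (auto simp: r_def)
  have ordered: "mdist X (r s) (r t) \<le> t - s" if "0 \<le> s" "s \<le> t" "t \<le> l + m" for s t
  proof -
    consider "t \<le> l" | "l < s" | "s \<le> l" "l < t" by linarith
    then show ?thesis
    proof cases
      case 1
      then show ?thesis using p(5)[of s t] that by (auto simp: r_def)
    next
      case 2
      then show ?thesis using q(5)[of "s - l" "t - l"] that by (auto simp: r_def)
    next
      case 3
      have "mdist X (p s) (q (t - l)) \<le> mdist X (p s) (p l) + mdist X (q 0) (q (t - l))"
        using 3 that p q r_in[of s] r_in[of t] r_in[of l] C
        by (auto simp: r_def intro!: mdist_triangle)
      also have "\<dots> \<le> (l - s) + (t - l)"
        using p(5)[of s l] q(5)[of 0 "t - l"] 3 that p(1) by auto
      finally show ?thesis using 3 by (simp add: r_def)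
    qed
  qed
  have "mdist X (r s) (r t) \<le> \<bar>s - t\<bar>" if "s \<in> {0..l + m}" "t \<in> {0..l + m}" for s t
    using ordered[of s t] ordered[of t s] that
    by (cases "s \<le> t") (auto simp: mdist_commute)
  moreover have "r 0 = x" "r (l + m) = z"
    using p q by (auto simp: r_def)
  ultimately show ?thesis
    unfolding lipschitz_joined_def using p(1) q(1) r_in
    by (intro conjI exI[of _ r]) auto
qed

lemma lipschitz_joined_longer:
  assumes "lipschitz_joined X C x y l" "l \<le> m" "C \<subseteq> mspace X"
  shows "lipschitz_joined X C x y m"
proof -
  have "y \<in> C" using assms(1) by (force simp: lipschitz_joined_def)
  then have "lipschitz_joined X C y y (m - l)"
    using assms by (intro lipschitz_joined_refl) auto
  from lipschitz_joined_trans[OF assms(1) this assms(3)] show ?thesis by simp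
qed

lemma induced_length_dist_le:
  assumes xy: "lipschitz_joined X C x y l" and C: "C \<subseteq> mspace X"
  shows "induced_length_dist X C x y \<le> ennreal l"
proof -
  obtain q where q: "0 \<le> l" "q ` {0..l} \<subseteq> C" "q 0 = x" "q l = y"
    "\<And>s t. s \<in> {0..l} \<Longrightarrow> t \<in> {0..l} \<Longrightarrow> mdist X (q s) (q t) \<le> \<bar>s - t\<bar>"
    using xy unfolding lipschitz_joined_def by blast
  define p where "p t = q (l * t)" for t
  have in_l: "l * t \<in> {0..l}" if "t \<in> {0..1}" for t
    using that q(1) by (auto intro: mult_left_le)
  have p_in: "p ` {0..1} \<subseteq> C" using in_l q(2) by (auto simp: p_def)
  have p_lip: "mdist X (p s) (p t) \<le> l * \<bar>s - t\<bar>" if "s \<in> {0..1}" "t \<in> {0..1}" for s t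
  proof -
    have "mdist X (p s) (p t) \<le> \<bar>l * s - l * t\<bar>"
      unfolding p_def using in_l that by (intro q(5)) auto
    also have "\<dots> = l * \<bar>s - t\<bar>"
      using q(1) by (simp add: abs_mult flip: right_diff_distrib)
    finally show ?thesis .
  qed
  have "Lipschitz_continuous_map (submetric euclidean_metric {0..1}) X p"
    unfolding Lipschitz_continuous_map_def using p_in C p_lip
    by (auto simp: dist_real_def intro!: exI[of _ l])
  then have "continuous_map (mtopology_of (submetric euclidean_metric {0..1})) (mtopology_of X) p"
    by (rule Lipschitz_continuous_imp_continuous_map)
  then have "pathin (subtopology (mtopology_of X) C) p"
    using p_in by (auto simp: pathin_def mtopology_of_submetric continuous_map_in_subtopology)
  moreover have "curve_length X p \<le> ennreal l"
    unfolding curve_length_def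
  proof (rule SUP_least, clarify)
    fix n :: nat and t :: "nat \<Rightarrow> real"
    assume t: "mono_on {..n} t" "t ` {..n} \<subseteq> {0..1}"
    have "(\<Sum>i<n. mdist X (p (t i)) (p (t (Suc i)))) \<le> (\<Sum>i<n. l * (t (Suc i) - t i))"
    proof (rule sum_mono)
      fix i assume "i \<in> {..<n}"
      then have "t i \<le> t (Suc i)" "t i \<in> {0..1}" "t (Suc i) \<in> {0..1}"
        using t(1) t(2)[unfolded image_subset_iff] by (auto intro: mono_onD)
      then show "mdist X (p (t i)) (p (t (Suc i))) \<le> l * (t (Suc i) - t i)"
        using p_lip[of "t i" "t (Suc i)"] by simp
    qed
    also have "\<dots> = l * (t n - t 0)"
      by (simp add: sum_lessThan_telescope flip: sum_distrib_left)
    also have "\<dots> \<le> l * 1"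
    proof (intro mult_left_mono)
      have "t n \<le> 1" "0 \<le> t 0" using t(2) by auto
      then show "t n - t 0 \<le> 1" by linarith
    qed (use q in auto)
    finally show "ennreal (\<Sum>i<n. mdist X (p (t i)) (p (t (Suc i)))) \<le> ennreal l"
      by (intro ennreal_leI) simp
  qed
  ultimately show ?thesis
    unfolding induced_length_dist_def
    using q by (intro INF_lower2[of p]) (auto simp: p_def)
qed

lemma dist_to_le: "a \<in> A \<Longrightarrow> dist_to X A x \<le> mdist X x a"
  unfolding dist_to_def by (intro cINF_lower bdd_belowI2[of _ 0]) auto

lemma dist_to_less_imp_near:
  "A \<noteq> {} \<Longrightarrow> dist_to X A x < l \<Longrightarrow> \<exists>a\<in>A. mdist X x a < l"
  unfolding dist_to_def by (subst (asm) cINF_less_iff) (auto intro!: bdd_belowI2[of _ 0])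

text \<open>
  The condition on distances is a strict inequality because the distance of a graph realization is
  an infimum of lengths of chains.
\<close>

locale length_space_subset =
  fixes X :: "'a metric" and A :: "'a set"
  assumes subset: "A \<subseteq> mspace X" and nonempty: "A \<noteq> {}"
    and length_space: "\<And>x y l. x \<in> mspace X \<Longrightarrow> y \<in> mspace X \<Longrightarrow> mdist X x y < l \<Longrightarrow>
      lipschitz_joined X (mspace X) x y l"
begin

lemma dist_to_nonneg: "0 \<le> dist_to X A x"
  unfolding dist_to_def by (intro cINF_greatest nonempty) auto

lemma dist_to_eq_0: "a \<in> A \<Longrightarrow> dist_to X A a = 0"
  using dist_to_le[of a A X a] dist_to_nonneg[of a] subset by fastforce

lemma dist_to_triangle:
  assumes "x \<in> mspace X" "y \<in> mspace X"
  shows "dist_to X A x \<le> dist_to X A y + mdist X x y"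
proof (rule field_le_epsilon)
  fix e :: real assume "e > 0"
  then obtain a where a: "a \<in> A" "mdist X y a < dist_to X A y + e"
    using dist_to_less_imp_near[OF nonempty, of X y "dist_to X A y + e"] by auto
  have "dist_to X A x \<le> mdist X x y + mdist X y a"
    using dist_to_le[OF a(1), of X x] mdist_triangle[of x X y a] assms a subset by auto
  then show "dist_to X A x \<le> dist_to X A y + mdist X x y + e" using a by simp
qed


lemma dist_to_change:
  assumes "x \<in> mspace X" "y \<in> mspace X"
  shows "\<bar>dist_to X A x - dist_to X A y\<bar> \<le> mdist X x y"
  using dist_to_triangle[OF assms] dist_to_triangle[OF assms(2,1)] mdist_commute[of X x y] by linarith

lemma mem_nbhd_compl: "x \<in> nbhd_compl X A r \<longleftrightarrow> x \<in> mspace X \<and> r \<le> dist_to X A x"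
  by (auto simp: nbhd_compl_def nbhd_def)

lemma nbhd_compl_subset: "nbhd_compl X A r \<subseteq> mspace X"
  by (auto simp: nbhd_compl_def)

text \<open>
  Follow a nearly shortest curve from \<open>y\<close> to \<open>A\<close> up to the first time at which the height is \<open>r\<close>.
  The rest of the curve still has length at least \<open>r\<close>, which leaves at most the height difference
  plus the error for the first part.
\<close>

lemma drop_to_level:
  assumes y: "y \<in> mspace X" and r: "0 < r" "r \<le> dist_to X A y"
  shows "\<exists>w\<in>nbhd_boundary X A r.
           lipschitz_joined X (nbhd_compl X A r) y w (dist_to X A y - r + 1)"
proof -
  define l where "l = dist_to X A y + 1"
  obtain a where a: "a \<in> A" "mdist X y a < l"
    using dist_to_less_imp_near[OF nonempty, of X y l] by (auto simp: l_def)
  then have "lipschitz_joined X (mspace X) y a l"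
    using length_space y subset by blast
  then obtain q where q: "0 \<le> l" "q ` {0..l} \<subseteq> mspace X" "q 0 = y" "q l = a"
    "\<And>s t. s \<in> {0..l} \<Longrightarrow> t \<in> {0..l} \<Longrightarrow> mdist X (q s) (q t) \<le> \<bar>s - t\<bar>"
    unfolding lipschitz_joined_def by blast
  have q_in: "q t \<in> mspace X" if "t \<in> {0..l}" for t
    using q(2) that by blast
  define g where "g t = dist_to X A (q t)" for t
  have g_lip: "\<bar>g s - g t\<bar> \<le> \<bar>s - t\<bar>" if "s \<in> {0..l}" "t \<in> {0..l}" for s t
    unfolding g_def using dist_to_change[OF q_in q_in, of s t] q(5)[of s t] that by linarith
  have cont: "continuous_on {0..l} g"
    unfolding continuous_on_iff dist_real_def using g_lip
    by (metis abs_minus_commute le_less_trans)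
  have g0: "g 0 = dist_to X A y" and gl: "g l = 0"
    using q(3,4) a dist_to_eq_0 by (auto simp: g_def)
  \<comment> \<open>Applied to \<open>l\<close>, this gives a time at height \<open>r\<close>; applied before the first such time, it shows
    that the curve has not been lower until then.\<close>
  have hits: "\<exists>t\<in>{0..s}. g t = r" if "s \<in> {0..l}" "g s \<le> r" for s
    using IVT2'[of g s r 0] that r g0 continuous_on_subset[OF cont, of "{0..s}"] by auto
  define T where "T = {0..l} \<inter> g -` {r}"
  have "compact T"
    using cont continuous_closed_preimage[OF cont closed_atLeastAtMost, of "{r}"]
    by (auto simp: T_def compact_eq_bounded_closed bounded_Int)
  moreover have "T \<noteq> {}"
    using hits[of l] q(1) gl r by (auto simp: T_def)
  ultimately obtain t where t: "t \<in> T" "\<And>s. s \<in> T \<Longrightarrow> t \<le> s"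
    using compact_attains_inf[of T] by blast
  have t_in: "t \<in> {0..l}" and gt: "g t = r" using t by (auto simp: T_def)
  have above: "r \<le> g s" if s: "s \<in> {0..t}" for s
  proof (rule ccontr)
    assume "\<not> r \<le> g s"
    then obtain u where "u \<in> {0..s}" "g u = r"
      using hits[of s] s t_in by auto
    moreover from this have "u = s"
      using t(2)[of u] s t_in by (auto simp: T_def)
    ultimately show False using \<open>\<not> r \<le> g s\<close> by simp
  qed
  have "lipschitz_joined X (nbhd_compl X A r) y (q t) t"
    unfolding lipschitz_joined_def
    using t_in q q_in above by (intro conjI exI[of _ q]) (auto simp: mem_nbhd_compl g_def)
  moreover have "t \<le> dist_to X A y - r + 1"
    using g_lip[of t l] t_in q(1) gt gl r by (auto simp: l_def)
  ultimately have "lipschitz_joined X (nbhd_compl X A r) y (q t) (dist_to X A y - r + 1)"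
    using nbhd_compl_subset by (rule lipschitz_joined_longer)
  moreover have "q t \<in> nbhd_boundary X A r"
    using gt q_in t_in by (auto simp: nbhd_boundary_def g_def)
  ultimately show ?thesis by blast
qed

lemma lipschitz_joined_off_nbhd:
  assumes xy: "lipschitz_joined X (mspace X) x y l" and x: "r + l \<le> dist_to X A x"
  shows "lipschitz_joined X (nbhd_compl X A r) x y l"
proof -
  obtain q where q: "0 \<le> l" "q ` {0..l} \<subseteq> mspace X" "q 0 = x" "q l = y"
    "\<And>s t. s \<in> {0..l} \<Longrightarrow> t \<in> {0..l} \<Longrightarrow> mdist X (q s) (q t) \<le> \<bar>s - t\<bar>"
    using xy unfolding lipschitz_joined_def by blast
  have "q t \<in> nbhd_compl X A r" if t: "t \<in> {0..l}" for t
  proof -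
    have "q 0 \<in> mspace X" "q t \<in> mspace X" using q(1,2) t by auto
    then have "dist_to X A x \<le> dist_to X A (q t) + mdist X (q 0) (q t)"
      using dist_to_triangle q(3) by blast
    moreover have "mdist X (q 0) (q t) \<le> l" using q(5)[of 0 t] t by auto
    ultimately show ?thesis using x \<open>q t \<in> mspace X\<close> by (auto simp: mem_nbhd_compl)
  qed
  then show ?thesis
    unfolding lipschitz_joined_def using q by (intro conjI exI[of _ q]) auto
qed

lemma lipschitz_joined_sequence:
  fixes z :: "nat \<Rightarrow> 'a"
  assumes "p \<le> q" and J: "0 \<le> J" and z: "\<And>i. z i \<in> mspace X"
    and step: "\<And>i. mdist X (z i) (z (Suc i)) < J"
    and high: "\<And>i. i \<in> {p..q} \<Longrightarrow> r + J \<le> dist_to X A (z i)"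
  shows "lipschitz_joined X (nbhd_compl X A r) (z p) (z q) (real (q - p) * J)"
  using assms(1) high
proof (induction q rule: dec_induct)
  case base
  then have "z p \<in> nbhd_compl X A r"
    using J z by (auto simp: mem_nbhd_compl intro: order_trans[of r "r + J"])
  then show ?case
    using lipschitz_joined_refl[of "z p" "nbhd_compl X A r" X 0] nbhd_compl_subset by simp
next
  case (step q)
  have "lipschitz_joined X (nbhd_compl X A r) (z p) (z q) (real (q - p) * J)"
    using step by simp
  moreover have "lipschitz_joined X (nbhd_compl X A r) (z q) (z (Suc q)) J"
    using length_space[OF z z assms(4)] step by (intro lipschitz_joined_off_nbhd) auto
  ultimately have "lipschitz_joined X (nbhd_compl X A r) (z p) (z (Suc q)) (real (q - p) * J + J)"
    using nbhd_compl_subset by (rule lipschitz_joined_trans)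
  moreover have "real (Suc q - p) * J = real (q - p) * J + J"
    using step by (simp add: Suc_diff_le algebra_simps)
  ultimately show ?case by simp
qed

lemma mdist_le_of_joined: "lipschitz_joined X C x y l \<Longrightarrow> mdist X x y \<le> l"
  unfolding lipschitz_joined_def by force

lemma lower_rel_div_1_le:
  assumes w: "w1 \<in> nbhd_boundary X A r" "w2 \<in> nbhd_boundary X A r"
    and joined: "lipschitz_joined X (nbhd_compl X A r) w1 w2 l"
    and far: "real n * r \<le> mdist X w1 w2"
  shows "lower_rel_div X A n 1 r \<le> ennreal l"
proof -
  have *: "induced_length_dist X (nbhd_compl X A r) w1 w2 \<le> ennreal l"
    using joined nbhd_compl_subset by (rule induced_length_dist_le)
  then have "induced_length_dist X (nbhd_compl X A r) w1 w2 < \<infinity>"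
    using ennreal_less_top le_less_trans unfolding infinity_ennreal_def by blast
  then show ?thesis
    unfolding lower_rel_div_def using w far *
    by (intro INF_lower2[of "(w1, w2)"]) auto
qed

end

section \<open>Divergence controls quasi-geodesics\<close>

text \<open>Strong quasiconvexity, for a subset of an arbitrary metric space.\<close>

definition morse_subset :: "'a metric \<Rightarrow> 'a set \<Rightarrow> bool" where
  "morse_subset X A \<longleftrightarrow>
     (\<forall>K\<ge>1. \<forall>C\<ge>0. \<exists>M. \<forall>a b c.
        a \<le> b \<and> quasi_geodesic X K C {a..b} c \<and> c a \<in> A \<and> c b \<in> A \<longrightarrow>
        c ` {a..b} \<subseteq> nbhd X A M)"

text \<open>
  \<open>h\<close> is to be read as a height profile: going back from \<open>m\<close>, one stops as soon as the height is
  within one step of the level \<open>L\<close>, or after \<open>n\<close> steps if that does not happen.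
\<close>

lemma descent_to_level:
  fixes h :: "nat \<Rightarrow> real"
  assumes start: "h 0 < L" and step: "\<And>i. h (Suc i) \<le> h i + J" and top: "L \<le> h m"
  shows "\<exists>p\<le>m. m - p \<le> n \<and> (\<forall>i\<in>{p..m}. L \<le> h i) \<and> (h p \<le> L + J \<or> m - p = n)"
proof (induction n)
  case 0
  show ?case using top by (intro exI[of _ m]) auto
next
  case (Suc n)
  then obtain p where p: "p \<le> m" "m - p \<le> n" "\<forall>i\<in>{p..m}. L \<le> h i"
    "h p \<le> L + J \<or> m - p = n" by blast
  show ?case
  proof (cases "h p \<le> L + J")
    case True
    then show ?thesis using p by (intro exI[of _ p]) auto
  next
    case False
    then have "p \<noteq> 0" using p(1,3) start by (metis atLeastAtMost_iff le0 not_le)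
    then obtain p' where p': "p = Suc p'" using not0_implies_Suc by blast
    have "L \<le> h p'" using step[of p'] False p' by auto
    then have "\<forall>i\<in>{p'..m}. L \<le> h i"
      using p(3) p' by (metis Suc_leI atLeastAtMost_iff le_neq_implies_less)
    then show ?thesis using p False p' by (intro exI[of _ p']) auto
  qed
qed

context length_space_subset
begin

text \<open>
  The sequence \<open>z\<close> samples a quasi-geodesic of maximal height \<open>R\<close>, with jumps shorter than \<open>J\<close>.  The
  window \<open>{p..q}\<close> around the highest point \<open>z m\<close> may be cut off after \<open>k\<close> steps on either side:
  otherwise an excursion much longer than \<open>R\<close> would give a curve that is too long.  The ratio \<open>n J K + 4\<close> of \<open>R\<close> and \<open>r\<close> makes a window that was not cut off long enough, and
  the number \<open>k\<close> of about \<open>K (n + 3) R\<close> steps makes a window that was cut off long enough, to keep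
  the end points \<open>n r\<close> apart after they have been dropped to height \<open>r\<close>.
\<close>

lemma lower_rel_div_le_of_excursion:
  fixes z :: "nat \<Rightarrow> 'a" and J K L R r :: real
  assumes z: "\<And>i. z i \<in> mspace X"
    and step: "\<And>i. mdist X (z i) (z (Suc i)) < J"
    and lower: "\<And>i j. i \<le> j \<Longrightarrow> j \<le> N \<Longrightarrow> real (j - i) / K - L \<le> mdist X (z i) (z j)"
    and ends: "z 0 \<in> A" "z N \<in> A"
    and m: "m \<le> N" and R: "R = dist_to X A (z m)"
    and max: "\<And>i. i \<le> N \<Longrightarrow> dist_to X A (z i) \<le> R"
    and const: "1 \<le> J" "1 \<le> K" "0 \<le> L"
    and Rr: "R = (real n * J * K + 4) * r"
    and large: "4 * J + J * K * (L + 4 * J + 2) \<le> R"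
  shows "lower_rel_div X A n 1 r
           \<le> ennreal ((4 + 2 * (K * (real n + 3) + 1) * J) * (real n * J * K + 4) * r)"
proof -
  define h where "h i = dist_to X A (z i)" for i
  have JK: "1 \<le> J * K" using const mult_mono[of 1 J 1 K] by simp
  have big: "L + 4 * J + 2 \<le> J * K * (L + 4 * J + 2)"
    using mult_right_mono[OF JK, of "L + 4 * J + 2"] const by simp
  have R_pos: "R \<ge> 1" "R \<ge> L + 2" "R \<ge> 4 * J" using large big const by linarith+
  have Q4: "4 \<le> real n * J * K + 4" using const by simp
  have r_pos: "0 < r"
    using Rr R_pos(1) Q4 mult_nonneg_nonpos[of "real n * J * K + 4" r] by (cases "0 < r") auto
  have r4: "4 * r \<le> R" using mult_right_mono[OF Q4, of r] r_pos Rr by simp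
  have h_step: "\<bar>h (Suc i) - h i\<bar> \<le> J" for i
    using dist_to_change[OF z z, of "Suc i" i] step[of i] mdist_commute[of X "z i" "z (Suc i)"]
    unfolding h_def by linarith
  have h_drop: "\<bar>h j - h i\<bar> \<le> real (j - i) * J" if "i \<le> j" for i j
    using that
  proof (induction j rule: dec_induct)
    case (step j)
    then have "real (Suc j - i) * J = real (j - i) * J + J"
      by (simp add: Suc_diff_le algebra_simps)
    then show ?case using step h_step[of j] by linarith
  qed simp
  \<comment> \<open>Two drops of at most \<open>R\<close> each and the additive error account for the summand 3.\<close>
  define B where "B = K * (real n + 3)"
  define k where "k = nat \<lceil>B * R\<rceil>"
  have B0: "0 \<le> B" using const by (simp add: B_def)
  have k: "B * R \<le> real k" "real k \<le> B * R + 1"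
    using B0 R_pos(1) by (auto simp: k_def)
  have top: "r + J \<le> h m" using r4 R_pos r_pos R by (simp add: h_def)
  have "\<exists>p\<le>m. m - p \<le> k \<and> (\<forall>i\<in>{p..m}. r + J \<le> h i) \<and> (h p \<le> r + J + J \<or> m - p = k)"
  proof (rule descent_to_level)
    show "h 0 < r + J" using dist_to_eq_0[OF ends(1)] r_pos const by (simp add: h_def)
    show "h (Suc i) \<le> h i + J" for i using h_step[of i] by linarith
  qed (rule top)
  then obtain p where p: "p \<le> m" "m - p \<le> k" "\<And>i. i \<in> {p..m} \<Longrightarrow> r + J \<le> h i"
    "h p \<le> r + J + J \<or> m - p = k" by blast
  \<comment> \<open>The other side, by reversing the sequence.\<close>
  have "\<exists>q\<le>N - m. N - m - q \<le> k \<and> (\<forall>i\<in>{q..N - m}. r + J \<le> h (N - i)) \<and>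
          (h (N - q) \<le> r + J + J \<or> N - m - q = k)"
  proof (rule descent_to_level)
    show "h (N - 0) < r + J" using dist_to_eq_0[OF ends(2)] r_pos const by (simp add: h_def)
    show "h (N - Suc i) \<le> h (N - i) + J" for i
    proof (cases "i < N")
      case True
      then show ?thesis using h_step[of "N - Suc i"] by (simp add: Suc_diff_Suc)
    qed (use const in auto)
    show "r + J \<le> h (N - (N - m))" using top m by simp
  qed
  then obtain q' where q': "q' \<le> N - m" "N - m - q' \<le> k"
    "\<And>i. i \<in> {q'..N - m} \<Longrightarrow> r + J \<le> h (N - i)" "h (N - q') \<le> r + J + J \<or> N - m - q' = k"
    by blast
  define q where "q = N - q'"
  have q: "m \<le> q" "q \<le> N" "q - m \<le> k" "h q \<le> r + J + J \<or> q - m = k"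
    using q' m by (auto simp: q_def)
  have q_high: "r + J \<le> h i" if "i \<in> {m..q}" for i
  proof -
    have "i \<le> N" "N - i \<in> {q'..N - m}" using that q(2) q'(1) m by (auto simp: q_def)
    then show ?thesis using q'(3)[of "N - i"] by simp
  qed
  have pq: "p \<le> q" using p q by simp
  have high: "r + J \<le> h i" if "i \<in> {p..q}" for i
    using p(3)[of i] q_high[of i] that by (cases "i \<le> m") auto
  have hp: "r + J \<le> h p" "h p \<le> R" and hq: "r + J \<le> h q" "h q \<le> R"
    using high pq max[of p] max[of q] p q m by (auto simp: h_def)
  obtain w1 where w1: "w1 \<in> nbhd_boundary X A r"
    "lipschitz_joined X (nbhd_compl X A r) (z p) w1 (h p - r + 1)"
    using drop_to_level[OF z r_pos, of p] hp const unfolding h_def by auto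
  obtain w2 where w2: "w2 \<in> nbhd_boundary X A r"
    "lipschitz_joined X (nbhd_compl X A r) (z q) w2 (h q - r + 1)"
    using drop_to_level[OF z r_pos, of q] hq const unfolding h_def by auto
  have "lipschitz_joined X (nbhd_compl X A r) (z p) (z q) (real (q - p) * J)"
    using pq z step high const unfolding h_def by (intro lipschitz_joined_sequence) auto
  then have joined: "lipschitz_joined X (nbhd_compl X A r) w1 w2
      ((h p - r + 1) + real (q - p) * J + (h q - r + 1))"
    using lipschitz_joined_trans[OF _ w2(2) nbhd_compl_subset]
      lipschitz_joined_trans[OF lipschitz_joined_sym[OF w1(2)] _ nbhd_compl_subset] by blast
  have w_in: "w1 \<in> mspace X" "w2 \<in> mspace X"
    using w1 w2 by (auto simp: nbhd_boundary_def)
  have pz: "mdist X (z p) (z q) \<le> (h p - r + 1) + mdist X w1 w2 + (h q - r + 1)"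
    using mdist_triangle[OF z w_in(1) z, of p q] mdist_triangle[OF w_in z, of q]
      mdist_le_of_joined[OF w1(2)] mdist_le_of_joined[OF w2(2)] mdist_commute[of X w2 "z q"]
    by linarith
  have zz: "real (q - p) / K - L \<le> mdist X (z p) (z q)"
    using lower pq q by blast
  have far: "real n * r \<le> mdist X w1 w2"
  proof (cases "q - p \<ge> k")
    case True
    have "(real n + 3) * R = B * R / K" using const by (simp add: B_def)
    also have "\<dots> \<le> real (q - p) / K"
      using True k const by (intro divide_right_mono) auto
    finally have "(real n + 3) * R \<le> real (q - p) / K" .
    moreover have "real n * r \<le> real n * R" using r4 r_pos by (intro mult_left_mono) auto
    ultimately show ?thesis
      using pz zz hp hq r_pos R_pos by (simp add: algebra_simps)
  next
    case False
    then have low: "h p \<le> r + J + J" "h q \<le> r + J + J" using p q by auto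
    have "R - (r + J + J) \<le> real (m - p) * J" "R - (r + J + J) \<le> real (q - m) * J"
      using h_drop[OF p(1)] h_drop[OF q(1)] low R unfolding h_def by linarith+
    then have "2 * (R - r - 2 * J) \<le> real (m - p) * J + real (q - m) * J" by argo
    also have "\<dots> = real (q - p) * J"
      using p q by (simp add: algebra_simps of_nat_diff)
    finally have "2 * (R - r - 2 * J) \<le> real (q - p) * J" .
    moreover have "real n * r * (J * K) + 4 * r = R" using Rr by (simp add: algebra_simps)
    ultimately have "(real n * r + (L + 4 * J + 2)) * (J * K) \<le> real (q - p) * J"
      using large r_pos by (simp add: algebra_simps)
    then have "(real n * r + (L + 4 * J + 2)) * K * J \<le> real (q - p) * J"
      by (simp add: mult_ac)
    then have "(real n * r + (L + 4 * J + 2)) * K \<le> real (q - p)"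
      using const by simp
    then have "real n * r + (L + 4 * J + 2) \<le> real (q - p) / K"
      using const by (simp add: pos_le_divide_eq)
    then show ?thesis using pz zz low by linarith
  qed
  have "(h p - r + 1) + real (q - p) * J + (h q - r + 1)
      \<le> (4 + 2 * (B + 1) * J) * R"
  proof -
    have "real (q - p) \<le> 2 * (B + 1) * R"
    proof -
      have "real (q - p) \<le> 2 * real k" using p q by linarith
      also have "\<dots> \<le> 2 * (B * R + 1)" using k by simp
      also have "\<dots> \<le> 2 * (B + 1) * R" using R_pos by (simp add: algebra_simps)
      finally show ?thesis .
    qed
    then have "real (q - p) * J \<le> 2 * (B + 1) * R * J"
      using const by (intro mult_right_mono) auto
    then show ?thesis using hp hq r_pos R_pos by (simp add: algebra_simps)
  qed
  also have "\<dots> = (4 + 2 * (K * (real n + 3) + 1) * J) * (real n * J * K + 4) * r"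
    by (simp add: B_def Rr)
  finally have len: "(h p - r + 1) + real (q - p) * J + (h q - r + 1) \<le> \<dots>" .
  have "lower_rel_div X A n 1 r \<le> ennreal ((h p - r + 1) + real (q - p) * J + (h q - r + 1))"
    by (rule lower_rel_div_1_le[OF w1(1) w2(1) joined far])
  with len show ?thesis by (meson ennreal_leI order_trans)
qed

theorem morse_subset_of_completely_super_linear:
  assumes "completely_super_linear (lower_rel_div X A n 1)"
  shows "morse_subset X A"
  unfolding morse_subset_def
proof (intro allI impI)
  fix K C :: real assume K: "1 \<le> K" and C: "0 \<le> C"
  define J where "J = K + C + 1"
  define L where "L = C + 1"
  define Q where "Q = real n * J * K + 4"
  define D where "D = (4 + 2 * (K * (real n + 3) + 1) * J) * Q"
  have const: "1 \<le> J" "0 \<le> L" using K C by (auto simp: J_def L_def)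
  have Q: "0 < Q" using const K by (simp add: Q_def add_nonneg_pos)
  have D: "0 < D" using const K Q unfolding D_def by (intro mult_pos_pos add_pos_nonneg) auto
  obtain b0 where b0: "\<And>x. 0 \<le> x \<Longrightarrow> lower_rel_div X A n 1 x \<le> ennreal (D * x) \<Longrightarrow> \<bar>x\<bar> \<le> b0"
    using assms D unfolding completely_super_linear_def bounded_iff real_norm_def by blast
  \<comment> \<open>Either \<open>R\<close> is too small for the previous lemma, or \<open>R / Q\<close> lies in a set bounded by \<open>b0\<close>.\<close>
  define R0 where "R0 = max (4 * J + J * K * (L + 4 * J + 2)) (Q * b0)"
  show "\<exists>M. \<forall>a b c. a \<le> b \<and> quasi_geodesic X K C {a..b} c \<and> c a \<in> A \<and> c b \<in> A \<longrightarrow>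
      c ` {a..b} \<subseteq> nbhd X A M"
  proof (intro exI allI impI)
    fix a b c
    assume "a \<le> b \<and> quasi_geodesic X K C {a..b} c \<and> c a \<in> A \<and> c b \<in> A"
    then have ab: "a \<le> b" and ends: "c a \<in> A" "c b \<in> A"
      and c_in: "\<And>t. t \<in> {a..b} \<Longrightarrow> c t \<in> mspace X"
      and c_lower: "\<And>s t. s \<in> {a..b} \<Longrightarrow> t \<in> {a..b} \<Longrightarrow> 1 / K * \<bar>s - t\<bar> - C \<le> mdist X (c s) (c t)"
      and c_upper: "\<And>s t. s \<in> {a..b} \<Longrightarrow> t \<in> {a..b} \<Longrightarrow> mdist X (c s) (c t) \<le> K * \<bar>s - t\<bar> + C"
      unfolding quasi_geodesic_def by auto
    \<comment> \<open>Quasi-geodesics may be discontinuous; only a sample at unit steps is used.  Beyond \<open>b\<close> it is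
      constant, and its last step may be shorter, which costs 1 in the lower bound.\<close>
    define \<tau> where "\<tau> i = min (a + real i) b" for i
    define z where "z i = c (\<tau> i)" for i
    define N where "N = nat \<lceil>b - a\<rceil>"
    have \<tau>_in: "\<tau> i \<in> {a..b}" for i using ab by (auto simp: \<tau>_def)
    have z_in: "z i \<in> mspace X" for i using c_in \<tau>_in by (simp add: z_def)
    have N: "b \<le> a + real N" "real N < b - a + 1" using ab by (auto simp: N_def) linarith+
    have near: "mdist X (c s) (c t) < J" if "s \<in> {a..b}" "t \<in> {a..b}" "\<bar>s - t\<bar> \<le> 1" for s t
    proof -
      have "K * \<bar>s - t\<bar> \<le> K * 1" using that K by (intro mult_left_mono) auto
      then show ?thesis using c_upper[OF that(1,2)] by (simp add: J_def)
    qed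
    have step: "mdist X (z i) (z (Suc i)) < J" for i
      unfolding z_def by (intro near \<tau>_in) (auto simp: \<tau>_def)
    have lower: "real (j - i) / K - L \<le> mdist X (z i) (z j)" if "i \<le> j" "j \<le> N" for i j
    proof -
      have "real (j - i) - 1 \<le> \<bar>\<tau> i - \<tau> j\<bar>"
        using that N by (auto simp: \<tau>_def min_def of_nat_diff)
      then have "(real (j - i) - 1) / K \<le> 1 / K * \<bar>\<tau> i - \<tau> j\<bar>"
        using K by (simp add: divide_right_mono)
      moreover have "1 / K \<le> 1" using K by simp
      ultimately show ?thesis
        using c_lower[OF \<tau>_in \<tau>_in, of i j] unfolding z_def L_def
        by (simp add: diff_divide_distrib)
    qed
    define R where "R = Max ((\<lambda>i. dist_to X A (z i)) ` {..N})"
    have "R \<in> (\<lambda>i. dist_to X A (z i)) ` {..N}" unfolding R_def by (intro Max_in) auto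
    then obtain m where m: "m \<le> N" "R = dist_to X A (z m)" by auto
    have max: "dist_to X A (z i) \<le> R" if "i \<le> N" for i
      using that by (auto simp: R_def)
    have "R \<le> R0"
    proof (rule ccontr)
      assume "\<not> R \<le> R0"
      then have large: "4 * J + J * K * (L + 4 * J + 2) \<le> R" "Q * b0 < R" by (auto simp: R0_def)
      have "lower_rel_div X A n 1 (R / Q) \<le> ennreal (D * (R / Q))"
        unfolding D_def Q_def
      proof (rule lower_rel_div_le_of_excursion[where z = z and N = N and m = m and L = L and R = R])
        show "z 0 \<in> A" "z N \<in> A" using ends ab N by (auto simp: z_def \<tau>_def min_def)
        show "R = (real n * J * K + 4) * (R / (real n * J * K + 4))"
          using Q by (simp add: Q_def)
      qed (use z_in step lower m max const K large in auto)
      moreover have "0 \<le> R / Q" using m(2) dist_to_nonneg Q by simp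
      ultimately have "\<bar>R / Q\<bar> \<le> b0" by (rule b0[rotated])
      then have "R \<le> Q * b0" using \<open>0 \<le> R / Q\<close> Q by (simp add: field_simps)
      with large show False by simp
    qed
    show "c ` {a..b} \<subseteq> nbhd X A (R0 + J)"
    proof clarify
      fix t assume t: "t \<in> {a..b}"
      define i where "i = nat \<lfloor>t - a\<rfloor>"
      have i: "real i \<le> t - a" "t - a < real i + 1" using t by (auto simp: i_def)
      then have "real i \<le> real N" using t N by auto
      then have "i \<le> N" by simp
      have "mdist X (c t) (z i) < J"
        unfolding z_def using i t by (intro near \<tau>_in) (auto simp: \<tau>_def)
      then have "dist_to X A (c t) < R0 + J"
        using dist_to_triangle[OF c_in[OF t] z_in[of i]] max[OF \<open>i \<le> N\<close>] \<open>R \<le> R0\<close> by linarith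
      then show "c t \<in> nbhd X A (R0 + J)" using c_in[OF t] by (simp add: nbhd_def)
    qed
  qed
qed

end

section \<open>Quasi-geodesics detect slow divergence\<close>

text \<open>
  Each step has length at most 1 and is charged the weight of its starting point.  Natural numbers
  as weights guarantee that a cheapest chain exists.
\<close>

inductive weighted_chain :: "'a metric \<Rightarrow> ('a \<Rightarrow> nat) \<Rightarrow> 'a \<Rightarrow> 'a \<Rightarrow> nat \<Rightarrow> bool" for X w where
  refl: "x \<in> mspace X \<Longrightarrow> weighted_chain X w x x 0"
| step: "x \<in> mspace X \<Longrightarrow> mdist X x y \<le> 1 \<Longrightarrow> weighted_chain X w y z n \<Longrightarrow>
         weighted_chain X w x z (w x + n)"

lemma weighted_chain_trans:
  "weighted_chain X w x y m \<Longrightarrow> weighted_chain X w y z n \<Longrightarrow> weighted_chain X w x z (m + n)"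
  by (induction rule: weighted_chain.induct) (auto simp: add.assoc intro: weighted_chain.step)

lemma weighted_chain_of_sequence:
  assumes "\<And>i. i \<le> m \<Longrightarrow> z i \<in> mspace X" "\<And>i. i < m \<Longrightarrow> mdist X (z i) (z (Suc i)) \<le> 1"
  shows "weighted_chain X w (z 0) (z m) (\<Sum>i<m. w (z i))"
  using assms
proof (induction m)
  case 0
  then show ?case by (auto intro: weighted_chain.refl)
next
  case (Suc m)
  have "weighted_chain X w (z m) (z (Suc m)) (w (z m) + 0)"
    using Suc.prems by (intro weighted_chain.step[OF _ _ weighted_chain.refl]) auto
  moreover have "weighted_chain X w (z 0) (z m) (\<Sum>i<m. w (z i))"
    using Suc by auto
  ultimately show ?case using weighted_chain_trans by fastforce
qed

lemma sequence_of_weighted_chain: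
  assumes "weighted_chain X w x y n"
  shows "\<exists>m z. z 0 = x \<and> z m = y \<and> (\<forall>i\<le>m. z i \<in> mspace X) \<and>
           (\<forall>i<m. mdist X (z i) (z (Suc i)) \<le> 1) \<and> (\<Sum>i<m. w (z i)) = n"
  using assms
proof (induction rule: weighted_chain.induct)
  case (refl x)
  then show ?case by (intro exI[of _ 0] exI[of _ "\<lambda>_. x"]) auto
next
  case (step x y v n)
  then obtain m z where z: "z 0 = y" "z m = v" "\<forall>i\<le>m. z i \<in> mspace X"
    "\<forall>i<m. mdist X (z i) (z (Suc i)) \<le> 1" "(\<Sum>i<m. w (z i)) = n" by blast
  show ?case
    using step z
    by (intro exI[of _ "Suc m"] exI[of _ "case_nat x z"])
      (auto split: nat.split simp: sum.lessThan_Suc_shift simp del: sum.lessThan_Suc)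
qed

lemma weighted_chain_of_joined:
  assumes "lipschitz_joined X C x y l" "C \<subseteq> mspace X" "l \<le> real N" "\<And>c. c \<in> C \<Longrightarrow> w c \<le> k"
  shows "\<exists>n\<le>k * N. weighted_chain X w x y n"
proof -
  obtain q where q: "0 \<le> l" "q ` {0..l} \<subseteq> C" "q 0 = x" "q l = y"
    "\<And>s t. s \<in> {0..l} \<Longrightarrow> t \<in> {0..l} \<Longrightarrow> mdist X (q s) (q t) \<le> \<bar>s - t\<bar>"
    using assms(1) unfolding lipschitz_joined_def by blast
  define z where "z i = q (min (real i) l)" for i
  have z_C: "z i \<in> C" for i using q(1,2) by (auto simp: z_def)
  have "mdist X (z i) (z (Suc i)) \<le> 1" for i
    using q(5)[of "min (real i) l" "min (real (Suc i)) l"] q(1)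
    unfolding z_def by (auto simp: min_def split: if_splits)
  then have "weighted_chain X w (z 0) (z N) (\<Sum>i<N. w (z i))"
    using z_C assms(2) by (intro weighted_chain_of_sequence) auto
  moreover have "z 0 = x" "z N = y" using q(1,3,4) assms(3) by (auto simp: z_def min_def)
  moreover have "(\<Sum>i<N. w (z i)) \<le> (\<Sum>i<N. k)"
    using assms(4) z_C by (intro sum_mono) auto
  ultimately show ?thesis by (auto simp: mult.commute)
qed

text \<open>
  The number of steps has to be bounded by the length, however fine the given subdivision is.  So
  points are skipped greedily as long as the skipped length is at most \<open>1 / 2\<close>; then every completed
  step uses up length more than \<open>1 / 2\<close> and still spans at most 1.
\<close>

lemma greedy_weighted_chain:
  fixes y :: "nat \<Rightarrow> 'a"
  assumes y: "\<And>i. i \<le> N \<Longrightarrow> y i \<in> mspace X" and w: "\<And>i. i \<le> N \<Longrightarrow> w (y i) \<le> 1"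
    and step: "\<And>i. i < N \<Longrightarrow> mdist X (y i) (y (Suc i)) \<le> 1 / 2"
  shows "\<exists>n. real n \<le> 2 * (\<Sum>i<N. mdist X (y i) (y (Suc i))) + 1 \<and>
           weighted_chain X w (y 0) (y N) n"
proof -
  define d where "d i = mdist X (y i) (y (Suc i))" for i
  have single: "weighted_chain X w (y i) (y j) (w (y i))"
    if "i \<le> N" "j \<le> N" "mdist X (y i) (y j) \<le> 1" for i j
    using weighted_chain.step[OF y[OF that(1)] that(3) weighted_chain.refl[OF y[OF that(2)]], of w] by simp
  have dist_le: "mdist X (y i) (y j) \<le> sum d {i..<j}" if "i \<le> j" "j \<le> N" for i j
    using that
  proof (induction j rule: dec_induct)
    case base
    then show ?case using y[of i] by auto
  next
    case (step j)
    then show ?case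
      using mdist_triangle[of "y i" X "y j" "y (Suc j)"] y by (auto simp: d_def)
  qed
  have "\<exists>j\<le>M. \<exists>n. real n \<le> 2 * sum d {..<j} \<and> weighted_chain X w (y 0) (y j) n \<and>
          sum d {j..<M} \<le> 1 / 2" if "M \<le> N" for M
    using that
  proof (induction M)
    case 0
    show ?case using y[of 0] by (auto intro: weighted_chain.refl)
  next
    case (Suc M)
    then obtain j n where j: "j \<le> M" "real n \<le> 2 * sum d {..<j}"
      "weighted_chain X w (y 0) (y j) n" "sum d {j..<M} \<le> 1 / 2" by auto
    have dM: "d M \<le> 1 / 2" using step Suc.prems by (simp add: d_def)
    have sum_Suc: "sum d {j..<Suc M} = sum d {j..<M} + d M" using j by simp
    show ?case
    proof (cases "sum d {j..<Suc M} \<le> 1 / 2")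
      case True
      then show ?thesis using j by (intro exI[of _ j] conjI exI[of _ n]) auto
    next
      case False
      have "mdist X (y j) (y (Suc M)) \<le> 1"
        using dist_le[of j "Suc M"] j Suc.prems dM sum_Suc by linarith
      then have "weighted_chain X w (y 0) (y (Suc M)) (n + w (y j))"
        using j Suc.prems by (intro weighted_chain_trans[OF j(3)] single) auto
      moreover have "sum d {..<Suc M} = sum d {..<j} + sum d {j..<Suc M}"
        using sum.atLeastLessThan_concat[of 0 j "Suc M" d] j by (simp only: lessThan_atLeast0)
      then have "real n + 1 \<le> 2 * sum d {..<Suc M}"
        using j(2) False by argo
      moreover have "w (y j) \<le> 1" using w j Suc.prems by auto
      ultimately show ?thesis
        by (intro exI[of _ "Suc M"] conjI exI[of _ "n + w (y j)"]) auto
    qed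
  qed
  from this[of N] obtain j n where j: "j \<le> N" "real n \<le> 2 * sum d {..<j}"
    "weighted_chain X w (y 0) (y j) n" "sum d {j..<N} \<le> 1 / 2" by auto
  have "weighted_chain X w (y 0) (y N) (n + w (y j))"
    using j dist_le[of j N] by (intro weighted_chain_trans[OF j(3)] single) auto
  moreover have "sum d {..<j} \<le> sum d {..<N}"
    using j by (intro sum_mono2) (auto simp: d_def)
  moreover have "w (y j) \<le> 1" using w j by auto
  ultimately show ?thesis
    using j(2) unfolding d_def by (intro exI[of _ "n + w (y j)"]) auto
qed

text \<open>
  Uniform continuity of the distance between two points of the path provides a subdivision fine
  enough for the greedy selection.
\<close>

lemma weighted_chain_of_path:
  assumes p: "pathin (subtopology (mtopology_of X) C) p" and L: "curve_length X p \<le> ennreal L"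
    and L0: "0 \<le> L" and w: "\<And>c. c \<in> C \<Longrightarrow> w c \<le> 1"
  shows "\<exists>n. real n \<le> 2 * L + 1 \<and> weighted_chain X w (p 0) (p 1) n"
proof -
  have cont: "continuous_map (top_of_set {0..1}) (mtopology_of X) p" and p_C: "p ` {0..1} \<subseteq> C"
    using p by (auto simp: pathin_def continuous_map_in_subtopology)
  have p_in: "p t \<in> mspace X" if "t \<in> {0..1}" for t
    using cont that unfolding continuous_map_def by auto
  define g where "g = (\<lambda>u. mdist X (p (fst u)) (p (snd u)))"
  have "continuous_on ({0..1} \<times> {0..1}) g"
  proof -
    have "continuous_map (top_of_set ({0..1} \<times> {0..1})) (top_of_set {0..1}) fst"
      "continuous_map (top_of_set ({0..1} \<times> {0..1})) (top_of_set {0..1}) snd"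
      by (auto simp: continuous_map_in_subtopology intro: continuous_intros)
    from continuous_map_compose[OF this(1) cont] continuous_map_compose[OF this(2) cont]
    have "continuous_map (top_of_set ({0..1::real} \<times> {0..1::real})) euclideanreal g"
      unfolding g_def comp_def by (rule continuous_map_mdist)
    then show ?thesis by simp
  qed
  then have "uniformly_continuous_on ({0..1} \<times> {0..1}) g"
    by (intro compact_uniformly_continuous compact_Times) auto
  then obtain e where e: "e > 0" "\<And>u v. u \<in> {0..1} \<times> {0..1} \<Longrightarrow> v \<in> {0..1} \<times> {0..1} \<Longrightarrow>
      dist u v < e \<Longrightarrow> dist (g u) (g v) < 1 / 2"
    unfolding uniformly_continuous_on_def by (metis half_gt_zero zero_less_one)
  obtain N where N: "0 < N" "1 / real N < e"
    using e(1) by (metis nat_approx_posE zero_less_Suc)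
  define y where "y i = p (real i / real N)" for i
  have t_in: "real i / real N \<in> {0..1}" if "i \<le> N" for i using that N by auto
  have "mdist X (y i) (y (Suc i)) \<le> 1 / 2" if i: "i < N" for i
  proof -
    let ?s = "real i / real N" and ?t = "real (Suc i) / real N"
    have "dist (?s, ?t) (?s, ?s) < e"
      using N by (simp add: dist_Pair_Pair dist_real_def flip: diff_divide_distrib)
    then have "dist (g (?s, ?t)) (g (?s, ?s)) < 1 / 2"
      using i t_in[of i] t_in[of "Suc i"] by (intro e(2)) auto
    moreover have "g (?s, ?s) = 0"
      using p_in t_in[of i] i by (simp add: g_def)
    ultimately show ?thesis by (simp add: g_def y_def)
  qed
  then have "\<exists>n. real n \<le> 2 * (\<Sum>i<N. mdist X (y i) (y (Suc i))) + 1 \<and>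
      weighted_chain X w (y 0) (y N) n"
    using t_in p_in p_C by (intro greedy_weighted_chain w) (auto simp: y_def)
  then obtain n where n: "real n \<le> 2 * (\<Sum>i<N. mdist X (y i) (y (Suc i))) + 1"
    "weighted_chain X w (y 0) (y N) n" by blast
  have "(\<Sum>i<N. mdist X (y i) (y (Suc i))) \<le> L"
  proof -
    have "mono_on {..N} (\<lambda>i. real i / real N)"
      by (intro mono_onI) (simp add: divide_right_mono)
    then have "ennreal (\<Sum>i<N. mdist X (y i) (y (Suc i))) \<le> curve_length X p"
      unfolding curve_length_def y_def
      using t_in by (intro SUP_upper2[of "(N, \<lambda>i. real i / real N)"]) auto
    then show ?thesis using L L0 by (metis ennreal_le_iff order_trans)
  qed
  moreover have "y 0 = p 0" "y N = p 1" using N by (auto simp: y_def)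
  ultimately show ?thesis using n by (intro exI[of _ n]) auto
qed

context length_space_subset
begin

text \<open>
  A piece of a cheapest chain is itself cheapest, so its cost is at most \<open>K\<close> times the number of
  steps of any chain between its end points, which can be taken close to their distance.  Since
  weights are at least 1, the cost in turn bounds the number of steps of the piece.  The additive
  constant 3 absorbs the rounding of distances to numbers of steps and of real parameters to indices.
\<close>

lemma minimal_weighted_chain_quasi_geodesic:
  assumes w: "\<And>x. x \<in> mspace X \<Longrightarrow> 1 \<le> w x \<and> w x \<le> K" and K: "1 \<le> K"
    and chain: "weighted_chain X w x y N"
  shows "\<exists>m z. z 0 = x \<and> z m = y \<and> (\<forall>i\<le>m. z i \<in> mspace X) \<and>
           mdist X x y \<le> real m \<and> (\<Sum>i<m. w (z i)) \<le> N \<and>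
           quasi_geodesic X (real K) 3 {0..real m} (\<lambda>t. z (nat \<lfloor>t\<rfloor>))"
proof -
  define n where "n = (LEAST n. weighted_chain X w x y n)"
  have "weighted_chain X w x y n" unfolding n_def by (rule LeastI[of "weighted_chain X w x y", OF chain])
  from sequence_of_weighted_chain[OF this]
  obtain m z where z: "z 0 = x" "z m = y" and "\<forall>i\<le>m. z i \<in> mspace X"
    and "\<forall>i<m. mdist X (z i) (z (Suc i)) \<le> 1" and cost: "(\<Sum>i<m. w (z i)) = n"
    by (elim exE conjE) (rule that)
  then have z_in: "\<And>i. i \<le> m \<Longrightarrow> z i \<in> mspace X"
    and unit_steps: "\<And>i. i < m \<Longrightarrow> mdist X (z i) (z (Suc i)) \<le> 1" by simp_all
  have seg: "weighted_chain X w (z i) (z j) (\<Sum>k=i..<j. w (z k))" if "i \<le> j" "j \<le> m" for i j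
  proof -
    have "weighted_chain X w (z (0 + i)) (z (j - i + i)) (\<Sum>k<j - i. w (z (k + i)))"
      using that z_in unit_steps by (intro weighted_chain_of_sequence[where z = "\<lambda>k. z (k + i)"]) auto
    moreover have "(\<Sum>k<j - i. w (z (k + i))) = (\<Sum>k=i..<j. w (z k))"
      using sum.shift_bounds_nat_ivl[of "\<lambda>k. w (z k)" 0 i "j - i"] that
      by (simp add: lessThan_atLeast0)
    ultimately show ?thesis using that by simp
  qed
  have upper: "mdist X (z i) (z j) \<le> real (j - i)" if "i \<le> j" "j \<le> m" for i j
    using that
  proof (induction j rule: dec_induct)
    case base
    then show ?case using z_in[of i] by simp
  next
    case (step j)
    then show ?case
      using mdist_triangle[of "z i" X "z j" "z (Suc j)"] z_in unit_steps[of j]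
      by (auto simp: Suc_diff_le)
  qed
  have lower: "real (j - i) \<le> real K * (mdist X (z i) (z j) + 2)" if ij: "i \<le> j" "j \<le> m" for i j
  proof -
    define d where "d = mdist X (z i) (z j)"
    have "lipschitz_joined X (mspace X) (z i) (z j) (d + 1)"
      using z_in ij by (intro length_space) (auto simp: d_def)
    moreover have "d + 1 \<le> real (nat \<lceil>d + 1\<rceil>)" by (rule real_nat_ceiling_ge)
    ultimately obtain k where k: "k \<le> K * nat \<lceil>d + 1\<rceil>" "weighted_chain X w (z i) (z j) k"
      using weighted_chain_of_joined[of X "mspace X" "z i" "z j" "d + 1" "nat \<lceil>d + 1\<rceil>" w K] w by auto
    \<comment> \<open>Replacing the piece from \<open>i\<close> to \<open>j\<close> by a shortest chain does not make the chain cheaper.\<close>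
    have "weighted_chain X w x y ((\<Sum>k=0..<i. w (z k)) + k + (\<Sum>k=j..<m. w (z k)))"
      using weighted_chain_trans[OF weighted_chain_trans[OF seg[of 0 i] k(2)] seg[of j m]] z ij by simp
    then have "n \<le> (\<Sum>k=0..<i. w (z k)) + k + (\<Sum>k=j..<m. w (z k))"
      unfolding n_def by (rule Least_le[of "weighted_chain X w x y"])
    moreover have "n = (\<Sum>k=0..<i. w (z k)) + (\<Sum>k=i..<j. w (z k)) + (\<Sum>k=j..<m. w (z k))"
      using ij cost by (simp add: sum.atLeastLessThan_concat lessThan_atLeast0)
    ultimately have "(\<Sum>k=i..<j. w (z k)) \<le> k" by simp
    moreover have "(\<Sum>k=i..<j. 1) \<le> (\<Sum>k=i..<j. w (z k))"
      using w z_in ij by (intro sum_mono) auto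
    ultimately have "j - i \<le> K * nat \<lceil>d + 1\<rceil>" using k(1) by simp
    then have "real (j - i) \<le> real K * real (nat \<lceil>d + 1\<rceil>)" by (metis of_nat_le_iff of_nat_mult)
    also have "\<dots> \<le> real K * (d + 2)"
    proof (rule mult_left_mono)
      have "0 \<le> d" by (simp add: d_def)
      then show "real (nat \<lceil>d + 1\<rceil>) \<le> d + 2" by linarith
    qed simp
    finally show ?thesis by (simp add: d_def)
  qed
  have ordered: "1 / real K * \<bar>s - t\<bar> - 3 \<le> mdist X (z (nat \<lfloor>s\<rfloor>)) (z (nat \<lfloor>t\<rfloor>)) \<and>
      mdist X (z (nat \<lfloor>s\<rfloor>)) (z (nat \<lfloor>t\<rfloor>)) \<le> real K * \<bar>s - t\<bar> + 3"
    if st: "0 \<le> s" "s \<le> t" "t \<le> real m" for s t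
  proof -
    let ?i = "nat \<lfloor>s\<rfloor>" and ?j = "nat \<lfloor>t\<rfloor>"
    have "\<lfloor>t\<rfloor> \<le> int m" using st(3) by linarith
    then have ij: "?i \<le> ?j" "?j \<le> m" using nat_mono[OF floor_mono[OF st(2)]] by auto
    have "real ?i \<le> s" "s < real ?i + 1" "real ?j \<le> t" "t < real ?j + 1"
      using st by linarith+
    moreover have "real (?j - ?i) = real ?j - real ?i" using ij(1) by (rule of_nat_diff)
    ultimately have close: "\<bar>real (?j - ?i) - \<bar>s - t\<bar>\<bar> \<le> 1" using st(2) by linarith
    have "\<bar>s - t\<bar> \<le> real K * (mdist X (z ?i) (z ?j) + 2) + 1"
      using lower[OF ij] close by linarith
    also have "\<dots> \<le> real K * (mdist X (z ?i) (z ?j) + 3)" using K by (simp add: algebra_simps)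
    finally have "1 / real K * \<bar>s - t\<bar> - 3 \<le> mdist X (z ?i) (z ?j)"
      using K by (simp add: field_simps)
    moreover have "\<bar>s - t\<bar> \<le> real K * \<bar>s - t\<bar>" using K by (simp add: mult_le_cancel_right1)
    ultimately show ?thesis using upper[OF ij] close by linarith
  qed
  have "quasi_geodesic X (real K) 3 {0..real m} (\<lambda>t. z (nat \<lfloor>t\<rfloor>))"
    unfolding quasi_geodesic_def
  proof (intro conjI ballI)
    show "(\<lambda>t. z (nat \<lfloor>t\<rfloor>)) ` {0..real m} \<subseteq> mspace X"
      by (auto intro!: z_in) linarith
    fix s t assume "s \<in> {0..real m}" "t \<in> {0..real m}"
    then have st: "0 \<le> s" "s \<le> real m" "0 \<le> t" "t \<le> real m" by simp_all
    have both: "1 / real K * \<bar>s - t\<bar> - 3 \<le> mdist X (z (nat \<lfloor>s\<rfloor>)) (z (nat \<lfloor>t\<rfloor>)) \<and>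
        mdist X (z (nat \<lfloor>s\<rfloor>)) (z (nat \<lfloor>t\<rfloor>)) \<le> real K * \<bar>s - t\<bar> + 3"
    proof (cases "s \<le> t")
      case True
      then show ?thesis using ordered st by blast
    next
      case False
      then have "t \<le> s" by simp
      from ordered[OF st(3) this st(2)] show ?thesis
        unfolding abs_minus_commute[of t s] mdist_commute[of X "z (nat \<lfloor>t\<rfloor>)" "z (nat \<lfloor>s\<rfloor>)"] .
    qed
    show "1 / real K * \<bar>s - t\<bar> - 3 \<le> mdist X (z (nat \<lfloor>s\<rfloor>)) (z (nat \<lfloor>t\<rfloor>))"
      by (rule conjunct1[OF both])
    show "mdist X (z (nat \<lfloor>s\<rfloor>)) (z (nat \<lfloor>t\<rfloor>)) \<le> real K * \<bar>s - t\<bar> + 3"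
      by (rule conjunct2[OF both])
  qed (rule is_interval_cc)
  moreover have "n \<le> N" unfolding n_def by (rule Least_le[of "weighted_chain X w x y", OF chain])
  ultimately show ?thesis
    using z z_in cost upper[of 0 m] by (intro exI[of _ m] exI[of _ z]) auto
qed

text \<open>
  A vertical descent is cheap above height \<open>e\<close> and costs \<open>K\<close> per step on the remaining length \<open>e\<close>.
  Costs are not symmetric, hence the two chains.
\<close>

lemma descent_chain:
  assumes x: "x \<in> nbhd_boundary X A r" and e: "0 < e" "e \<le> r"
    and w: "\<And>x. x \<in> nbhd_compl X A e \<Longrightarrow> w x \<le> 1" "\<And>x. x \<in> mspace X \<Longrightarrow> w x \<le> K"
  shows "\<exists>a\<in>A. mdist X x a \<le> r + 2 \<and>
           (\<exists>n. real n \<le> r + 2 + real K * (e + 2) \<and> weighted_chain X w x a n) \<and>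
           (\<exists>n. real n \<le> r + 2 + real K * (e + 2) \<and> weighted_chain X w a x n)"
proof -
  have x_in: "x \<in> mspace X" and hx: "dist_to X A x = r" using x by (auto simp: nbhd_boundary_def)
  obtain v where v: "v \<in> nbhd_boundary X A e"
    and xv: "lipschitz_joined X (nbhd_compl X A e) x v (r - e + 1)"
    using drop_to_level[OF x_in e(1)] e(2) hx by auto
  have v_in: "v \<in> mspace X" and hv: "dist_to X A v = e" using v by (auto simp: nbhd_boundary_def)
  obtain a where a: "a \<in> A" "mdist X v a < e + 1" using dist_to_less_imp_near[OF nonempty, of X v "e + 1"] hv by auto
  have va: "lipschitz_joined X (mspace X) v a (e + 1)"
    using a subset v_in by (intro length_space) auto
  define M N where "M = nat \<lceil>r - e + 1\<rceil>" and "N = nat \<lceil>e + 1\<rceil>"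
  have MN: "r - e + 1 \<le> real M" "e + 1 \<le> real N" "real M \<le> r + 2" "real N \<le> e + 2"
    using e by (auto simp: M_def N_def) linarith+
  have cost: "real (m + n) \<le> r + 2 + real K * (e + 2)" if "m \<le> 1 * M" "n \<le> K * N" for m n
  proof -
    have "real n \<le> real K * real N" using that(2) by (metis of_nat_le_iff of_nat_mult)
    also have "\<dots> \<le> real K * (e + 2)" using MN by (intro mult_left_mono) auto
    finally show ?thesis using that MN by auto
  qed
  obtain m where m: "m \<le> 1 * M" "weighted_chain X w x v m"
    using weighted_chain_of_joined[where w = w, OF xv nbhd_compl_subset MN(1) w(1)] by blast
  obtain n where n: "n \<le> K * N" "weighted_chain X w v a n"
    using weighted_chain_of_joined[where w = w, OF va order_refl MN(2) w(2)] by blast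
  obtain m' where m': "m' \<le> 1 * M" "weighted_chain X w v x m'"
    using weighted_chain_of_joined[where w = w, OF lipschitz_joined_sym[OF xv] nbhd_compl_subset MN(1) w(1)] by blast
  obtain n' where n': "n' \<le> K * N" "weighted_chain X w a v n'"
    using weighted_chain_of_joined[where w = w, OF lipschitz_joined_sym[OF va] order_refl MN(2) w(2)] by blast
  have "weighted_chain X w x a (m + n)" using m(2) n(2) by (rule weighted_chain_trans)
  moreover have "weighted_chain X w a x (m' + n')"
    using weighted_chain_trans[OF n'(2) m'(2)] by (simp add: add.commute)
  moreover have "mdist X x a \<le> r + 2"
    using mdist_triangle[OF x_in v_in, of a] mdist_le_of_joined[OF xv] a subset by auto
  ultimately show ?thesis using a(1) cost[OF m(1) n(1)] cost[OF m'(1) n'(1)] by blast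
qed

text \<open>
  The value 3 leaves room for the two descents: points at height \<open>r\<close> that are \<open>3 r\<close> apart have
  feet on \<open>A\<close> that are still almost \<open>r\<close> apart.
\<close>

theorem completely_super_linear_of_morse_subset:
  assumes morse: "morse_subset X A" and \<rho>: "0 < \<rho>" "\<rho> \<le> 1"
  shows "completely_super_linear (lower_rel_div X A 3 \<rho>)"
  unfolding completely_super_linear_def
proof (intro allI impI)
  fix C :: real assume C: "0 < C"
  \<comment> \<open>With \<open>e \<le> r / 8\<close> and \<open>r > 64\<close>, comparing costs will give \<open>5 / 8 * K * r \<le> (2 * C + 4) * r + 5\<close>,
    which this choice of \<open>K\<close> contradicts.\<close>
  define K where "K = nat \<lceil>4 * C + 16\<rceil>"
  have K: "4 * C + 16 \<le> real K" unfolding K_def by (rule real_nat_ceiling_ge)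
  then have K1: "1 \<le> K" using C by (cases K) auto
  obtain M where M: "\<And>a b c. a \<le> b \<Longrightarrow> quasi_geodesic X (real K) 3 {a..b} c \<Longrightarrow> c a \<in> A \<Longrightarrow>
      c b \<in> A \<Longrightarrow> c ` {a..b} \<subseteq> nbhd X A M"
    using morse K1 unfolding morse_subset_def
    by (metis of_nat_1 of_nat_le_iff zero_le_numeral)
  define \<epsilon> where "\<epsilon> = min \<rho> (1 / 8)"
  have \<epsilon>: "0 < \<epsilon>" "\<epsilon> \<le> \<rho>" "\<epsilon> \<le> 1 / 8" using \<rho> by (auto simp: \<epsilon>_def)
  define R0 where "R0 = max 64 (M / \<epsilon>)"
  have "r \<le> R0" if slow: "0 \<le> r" "lower_rel_div X A 3 \<rho> r \<le> ennreal (C * r)" for r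
  proof (rule ccontr)
    assume "\<not> r \<le> R0"
    then have r: "64 < r" and "M / \<epsilon> < r" by (auto simp: R0_def)
    then have Mr: "M < \<epsilon> * r" using \<epsilon> by (simp add: pos_divide_less_eq mult.commute)
    define e where "e = \<epsilon> * r"
    have e: "0 < e" "e \<le> \<rho> * r" "e \<le> r / 8" "e \<le> r" "M < e"
      using \<epsilon> r Mr mult_right_mono[of \<epsilon> \<rho> r] mult_right_mono[of \<epsilon> "1/8" r] by (auto simp: e_def)
    define L where "L = (C + 1) * r"
    have L: "0 \<le> L" using C r by (simp add: L_def)
    have "lower_rel_div X A 3 \<rho> r < ennreal L"
      by (rule le_less_trans[OF slow(2)])
        (use C r in \<open>auto simp: L_def intro!: ennreal_lessI mult_strict_right_mono\<close>)
    then obtain x1 x2 where x: "x1 \<in> nbhd_boundary X A r" "x2 \<in> nbhd_boundary X A r"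
      "3 * r \<le> mdist X x1 x2" "induced_length_dist X (nbhd_compl X A (\<rho> * r)) x1 x2 < ennreal L"
      unfolding lower_rel_div_def INF_less_iff by auto
    then obtain p where p: "pathin (subtopology (mtopology_of X) (nbhd_compl X A (\<rho> * r))) p"
      "p 0 = x1" "p 1 = x2" "curve_length X p < ennreal L"
      unfolding induced_length_dist_def INF_less_iff by auto
    define w where "w x = (if dist_to X A x < e then K else 1)" for x
    have w: "1 \<le> w x \<and> w x \<le> K" for x using K1 by (simp add: w_def)
    have w_high: "w x \<le> 1" if "x \<in> nbhd_compl X A e" for x
      using that by (auto simp: w_def mem_nbhd_compl)
    have w_path: "w x \<le> 1" if "x \<in> nbhd_compl X A (\<rho> * r)" for x
      using that e by (auto simp: w_def mem_nbhd_compl)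
    have w_le: "w x \<le> K" for x using w by blast
    obtain n0 where n0: "real n0 \<le> 2 * L + 1" "weighted_chain X w x1 x2 n0"
      using weighted_chain_of_path[where w = w, OF p(1) less_imp_le[OF p(4)] L w_path] p by auto
    obtain a1 n1 where a1: "a1 \<in> A" "mdist X x1 a1 \<le> r + 2"
      and n1: "real n1 \<le> r + 2 + real K * (e + 2)" "weighted_chain X w a1 x1 n1"
      using descent_chain[where w = w, OF x(1) e(1,4) w_high w_le] by blast
    obtain a2 n2 where a2: "a2 \<in> A" "mdist X x2 a2 \<le> r + 2"
      and n2: "real n2 \<le> r + 2 + real K * (e + 2)" "weighted_chain X w x2 a2 n2"
      using descent_chain[where w = w, OF x(2) e(1,4) w_high w_le] by blast
    have "weighted_chain X w a1 a2 (n1 + n0 + n2)"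
      using weighted_chain_trans[OF weighted_chain_trans[OF n1(2) n0(2)] n2(2)] .
    then obtain m z where z: "z 0 = a1" "z m = a2" "mdist X a1 a2 \<le> real m"
      "(\<Sum>i<m. w (z i)) \<le> n1 + n0 + n2"
      "quasi_geodesic X (real K) 3 {0..real m} (\<lambda>t. z (nat \<lfloor>t\<rfloor>))"
      using minimal_weighted_chain_quasi_geodesic[where w = w, OF w K1] by blast
    have near: "(\<lambda>t. z (nat \<lfloor>t\<rfloor>)) ` {0..real m} \<subseteq> nbhd X A M"
      using z a1 a2 by (intro M) auto
    have "w (z i) = K" if "i < m" for i
    proof -
      have "z (nat \<lfloor>real i\<rfloor>) \<in> nbhd X A M" using near that by (intro subsetD[OF near] image_eqI[of _ _ "real i"]) auto
      then show ?thesis using e(5) by (simp add: nbhd_def w_def)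
    qed
    \<comment> \<open>The Morse property confines the cheapest chain to the expensive region.\<close>
    then have "(\<Sum>i<m. w (z i)) = m * K" by simp
    then have "real m * real K \<le> real (n1 + n0 + n2)"
      using z(4) by (metis of_nat_le_iff of_nat_mult)
    moreover have "r - 4 \<le> real m"
    proof -
      have pts: "x1 \<in> mspace X" "x2 \<in> mspace X" "a1 \<in> mspace X" "a2 \<in> mspace X"
        using x a1 a2 subset by (auto simp: nbhd_boundary_def)
      have "mdist X x1 x2 \<le> mdist X x1 a1 + mdist X a1 a2 + mdist X x2 a2"
        using mdist_triangle[OF pts(1,3,2)] mdist_triangle[OF pts(3,4,2)] mdist_commute[of X a2 x2] by linarith
      then show ?thesis using a1 a2 x(3) z(3) by linarith
    qed
    then have "(r - 4) * real K \<le> real m * real K" by (intro mult_right_mono) auto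
    ultimately have "(r - 4) * real K \<le> 2 * (r + 2 + real K * (e + 2)) + 2 * L + 1"
      using n0 n1 n2 by simp
    moreover have "real K * (e + 2) \<le> real K * (r / 8 + 2)"
      using e by (intro mult_left_mono) auto
    ultimately have "real K * (3 * r / 4 - 8) \<le> 2 * r + 5 + 2 * L"
      by (simp add: algebra_simps)
    moreover have "(4 * C + 16) * (5 * r / 8) \<le> real K * (3 * r / 4 - 8)"
      using K r C by (intro mult_mono) auto
    moreover have "0 < C * r" using C r by simp
    ultimately show False using r by (simp add: L_def algebra_simps)
  qed
  then show "bounded {x. 0 \<le> x \<and> lower_rel_div X A 3 \<rho> x \<le> ennreal (C * x)}"
    by (intro boundedI[of _ R0]) auto
qed

end

section \<open>Independence of the generating set\<close>

text \<open>
  Composition with \<open>f\<close> turns quasi-geodesics of \<open>X\<close> into quasi-geodesics of \<open>Y\<close>, and the lower bound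
  for distances in \<open>Y\<close> brings closeness to \<open>f ` A\<close> back to closeness to \<open>A\<close>.
\<close>

lemma morse_subset_quasi_isometric_pullback:
  assumes f: "\<And>x. x \<in> mspace X \<Longrightarrow> f x \<in> mspace Y" and A: "A \<subseteq> mspace X" "A \<noteq> {}"
    and const: "1 \<le> \<Lambda>" "0 \<le> B"
    and lower: "\<And>x y. x \<in> mspace X \<Longrightarrow> y \<in> mspace X \<Longrightarrow> mdist X x y \<le> \<Lambda> * mdist Y (f x) (f y) + B"
    and upper: "\<And>x y. x \<in> mspace X \<Longrightarrow> y \<in> mspace X \<Longrightarrow> mdist Y (f x) (f y) \<le> \<Lambda> * mdist X x y + B"
    and morse: "morse_subset Y (f ` A)"
  shows "morse_subset X A"
  unfolding morse_subset_def
proof (intro allI impI)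
  fix K C :: real assume K: "1 \<le> K" and C: "0 \<le> C"
  have K': "1 \<le> \<Lambda> * K" "0 \<le> \<Lambda> * C + B"
    using const K C mult_mono[of 1 \<Lambda> 1 K] by auto
  then obtain M where M: "\<And>a b c. a \<le> b \<Longrightarrow> quasi_geodesic Y (\<Lambda> * K) (\<Lambda> * C + B) {a..b} c \<Longrightarrow>
      c a \<in> f ` A \<Longrightarrow> c b \<in> f ` A \<Longrightarrow> c ` {a..b} \<subseteq> nbhd Y (f ` A) M"
    using morse unfolding morse_subset_def by meson
  show "\<exists>M. \<forall>a b c. a \<le> b \<and> quasi_geodesic X K C {a..b} c \<and> c a \<in> A \<and> c b \<in> A \<longrightarrow>
      c ` {a..b} \<subseteq> nbhd X A M"
  proof (intro exI allI impI)
    fix a b c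
    assume "a \<le> b \<and> quasi_geodesic X K C {a..b} c \<and> c a \<in> A \<and> c b \<in> A"
    then have ab: "a \<le> b" and ends: "c a \<in> A" "c b \<in> A"
      and c_in: "\<And>t. t \<in> {a..b} \<Longrightarrow> c t \<in> mspace X"
      and c_lower: "\<And>s t. s \<in> {a..b} \<Longrightarrow> t \<in> {a..b} \<Longrightarrow> 1 / K * \<bar>s - t\<bar> - C \<le> mdist X (c s) (c t)"
      and c_upper: "\<And>s t. s \<in> {a..b} \<Longrightarrow> t \<in> {a..b} \<Longrightarrow> mdist X (c s) (c t) \<le> K * \<bar>s - t\<bar> + C"
      unfolding quasi_geodesic_def by auto
    have "quasi_geodesic Y (\<Lambda> * K) (\<Lambda> * C + B) {a..b} (f \<circ> c)"
      unfolding quasi_geodesic_def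
    proof (intro conjI ballI)
      show "(f \<circ> c) ` {a..b} \<subseteq> mspace Y" using f c_in by auto
      fix s t assume st: "s \<in> {a..b}" "t \<in> {a..b}"
      have "\<Lambda> * mdist X (c s) (c t) \<le> \<Lambda> * (K * \<bar>s - t\<bar> + C)"
        using c_upper[OF st] const by (intro mult_left_mono) auto
      then show "mdist Y ((f \<circ> c) s) ((f \<circ> c) t) \<le> \<Lambda> * K * \<bar>s - t\<bar> + (\<Lambda> * C + B)"
        using upper[OF c_in c_in, OF st] by (simp add: algebra_simps)
      have "1 / K * \<bar>s - t\<bar> - C - B \<le> \<Lambda> * mdist Y (f (c s)) (f (c t))"
        using lower[OF c_in c_in, OF st] c_lower[OF st] by simp
      then have "(1 / K * \<bar>s - t\<bar> - C - B) / \<Lambda> \<le> mdist Y (f (c s)) (f (c t))"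
        using const by (simp add: pos_divide_le_eq mult.commute)
      moreover have "(C + B) / \<Lambda> \<le> C + B"
        using const C by (simp add: pos_divide_le_eq mult_le_cancel_left1)
      moreover have "C \<le> \<Lambda> * C" using const C by (simp add: mult_le_cancel_right1)
      ultimately show "1 / (\<Lambda> * K) * \<bar>s - t\<bar> - (\<Lambda> * C + B) \<le> mdist Y ((f \<circ> c) s) ((f \<circ> c) t)"
        by (simp add: diff_divide_distrib add_divide_distrib mult.commute)
    qed (rule is_interval_cc)
    then have near: "(f \<circ> c) ` {a..b} \<subseteq> nbhd Y (f ` A) M"
      using ab ends by (intro M) auto
    show "c ` {a..b} \<subseteq> nbhd X A (\<Lambda> * M + B + 1)"
    proof clarify
      fix t assume t: "t \<in> {a..b}"
      then have "dist_to Y (f ` A) (f (c t)) < M"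
        using subsetD[OF near imageI[OF t]] by (simp add: nbhd_def)
      then obtain x where x: "x \<in> A" "mdist Y (f (c t)) (f x) < M"
        using dist_to_less_imp_near[of "f ` A" Y "f (c t)" M] A(2) by auto
      then have "\<Lambda> * mdist Y (f (c t)) (f x) \<le> \<Lambda> * M" using const by (intro mult_left_mono) auto
      then have "mdist X (c t) x \<le> \<Lambda> * M + B"
        using lower[OF c_in[OF t], of x] x A(1) by force
      then show "c t \<in> nbhd X A (\<Lambda> * M + B + 1)"
        using dist_to_le[OF x(1), of X "c t"] c_in[OF t] by (auto simp: nbhd_def)
    qed
  qed
qed

locale cayley = group G for G :: "('a, 'b) monoid_scheme" (structure) +
  fixes S :: "'a set"
  assumes generating: "finite_generating_set G S"
begin

abbreviation "X \<equiv> cayley_graph G S"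
abbreviation "chain \<equiv> graph_chain (carrier G) (cayley_edge G S)"

lemma mspace_X: "mspace X = graph_points (carrier G) (cayley_edge G S)"
  using mspace_cayley_graph[OF is_group generating] .

lemma vertex_in [simp]: "g \<in> carrier G \<Longrightarrow> vertex g \<in> mspace X"
  by (auto simp: mspace_X graph_points_def)

lemma chain_in: "chain x y l \<Longrightarrow> x \<in> mspace X \<and> y \<in> mspace X"
  using graph_chain_points mspace_X by blast

lemma mdist_X: "x \<in> mspace X \<Longrightarrow> y \<in> mspace X \<Longrightarrow> mdist X x y = Inf {l. chain x y l}"
  using mdist_cayley_graph[OF is_group generating] by (simp add: graph_dist_def)

lemma mdist_le_chain:
  assumes "chain x y l"
  shows "mdist X x y \<le> l"
proof -
  have "0 \<le> m" if "chain x y m" for m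
    using graph_chain_lower[OF that, of undefined] by linarith
  then have "Inf {l. chain x y l} \<le> l"
    using assms by (intro cInf_lower bdd_belowI[of _ 0]) auto
  then show ?thesis using mdist_X chain_in[OF assms] by simp
qed

lemma chain_exists:
  assumes "x \<in> mspace X" "y \<in> mspace X"
  shows "\<exists>l. chain x y l"
proof -
  have to_vertex: "\<exists>u\<in>carrier G. \<exists>l. chain x (vertex u) l" if "x \<in> mspace X" for x
    using that graph_chain_to_vertex[of x "carrier G" "cayley_edge G S"]
    by (auto simp: mspace_X cayley_edge_def)
  obtain u k where u: "u \<in> carrier G" "chain x (vertex u) k" using to_vertex assms by blast
  obtain v m where v: "v \<in> carrier G" "chain y (vertex v) m" using to_vertex assms by blast
  have "S \<subseteq> carrier G" "inv u \<otimes> v \<in> generate G S"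
    using generating u v by (auto simp: finite_generating_set_def)
  from cayley_connected[OF is_group this u(1)] obtain l where "chain (vertex u) (vertex v) l"
    using u v by (auto simp flip: m_assoc)
  then show ?thesis
    using graph_chain_trans[OF graph_chain_trans[OF u(2)] graph_chain_sym[OF v(2)]] by blast
qed

lemma edge_point_in:
  "cayley_edge G S u v \<Longrightarrow> t \<in> {0..1} \<Longrightarrow> edge_point u v t \<in> mspace X"
  by (auto simp: mspace_X graph_points_def)

lemma lipschitz_joined_of_chain:
  assumes "chain x y l"
  shows "lipschitz_joined X (mspace X) x y l"
  using assms
proof (induction rule: graph_chain.induct)
  case (refl x)
  then show ?case using lipschitz_joined_refl[of x "mspace X" X 0] by (simp add: mspace_X)
next
  case (step u v s t y l)
  have "lipschitz_joined X (mspace X) (edge_point u v s) (edge_point u v t) \<bar>s - t\<bar>"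
    unfolding lipschitz_joined_def
  proof (intro conjI exI)
    let ?q = "\<lambda>\<tau>. edge_point u v (if s \<le> t then s + \<tau> else s - \<tau>)"
    show "?q ` {0..\<bar>s - t\<bar>} \<subseteq> mspace X"
      using step by (auto intro!: edge_point_in)
    show "\<forall>a\<in>{0..\<bar>s - t\<bar>}. \<forall>b\<in>{0..\<bar>s - t\<bar>}. mdist X (?q a) (?q b) \<le> \<bar>a - b\<bar>"
      using step by (auto intro!: order_trans[OF mdist_le_chain[OF graph_chain_step1]])
  qed auto
  then show ?case using step.IH by (rule lipschitz_joined_trans) simp
qed

lemma length_space_subset_vertices:
  assumes "H \<subseteq> carrier G" "H \<noteq> {}"
  shows "length_space_subset X (vertex ` H)"
proof
  show "vertex ` H \<subseteq> mspace X" "vertex ` H \<noteq> {}" using assms by auto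
  fix x y l assume xy: "x \<in> mspace X" "y \<in> mspace X" and "mdist X x y < l"
  then have lt: "Inf {l. chain x y l} < l" by (simp add: mdist_X)
  have "{l. chain x y l} \<noteq> {}" using chain_exists[OF xy] by auto
  from cInf_lessD[OF this lt] obtain m where "chain x y m" "m < l" by blast
  then show "lipschitz_joined X (mspace X) x y l"
    using lipschitz_joined_of_chain lipschitz_joined_longer[of X "mspace X" x y m l] by simp
qed

text \<open>
  A function on the vertices that changes by at most 1 along edges extends to a 1-Lipschitz function
  on the graph: in barycentric coordinates, the extension is the linear one.  This bounds distances
  from below without an analysis of shortest chains.
\<close>

lemma abs_diff_le_mdist_vertices:
  fixes D :: "'a \<Rightarrow> real"
  assumes D: "\<And>u v. cayley_edge G S u v \<Longrightarrow> \<bar>D u - D v\<bar> \<le> 1"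
    and uv: "u \<in> carrier G" "v \<in> carrier G"
  shows "\<bar>D u - D v\<bar> \<le> mdist X (vertex u) (vertex v)"
proof -
  define F where "F x = (\<Sum>w | x w \<noteq> 0. x w * D w)" for x :: "'a \<Rightarrow> real"
  have F_edge: "F (edge_point a b t) = (1 - t) * D a + t * D b" if "a \<noteq> b" for a b t
  proof -
    have "F (edge_point a b t) = (\<Sum>w\<in>{a, b}. edge_point a b t w * D w)"
      unfolding F_def by (intro sum.mono_neutral_left) (auto simp: edge_point_def)
    then show ?thesis using that by (simp add: edge_point_def)
  qed
  have F_vertex: "F (vertex a) = D a" for a
  proof -
    have "{w. vertex a w \<noteq> 0} = {a}" by (auto simp: vertex_def)
    then show ?thesis by (simp add: F_def vertex_def)
  qed
  have F_chain: "\<bar>F x - F y\<bar> \<le> l" if "chain x y l" for x y l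
    using that
  proof (induction rule: graph_chain.induct)
    case (step a b s t y l)
    have ab: "a \<noteq> b" using step by (simp add: cayley_edge_def)
    have "F (edge_point a b s) - F (edge_point a b t) = (t - s) * (D a - D b)"
      unfolding F_edge[OF ab] by (simp add: algebra_simps)
    then have "\<bar>F (edge_point a b s) - F (edge_point a b t)\<bar> \<le> \<bar>s - t\<bar> * 1"
      using D[of a b] step by (simp add: abs_mult abs_minus_commute mult_left_le)
    then show ?case
      using step.IH abs_triangle_ineq[of "F (edge_point a b s) - F (edge_point a b t)"
          "F (edge_point a b t) - F y"] by simp
  qed simp
  have "\<bar>D u - D v\<bar> \<le> Inf {l. chain (vertex u) (vertex v) l}"
    using chain_exists[of "vertex u" "vertex v"] uv F_chain[of "vertex u" "vertex v"]
    by (intro cInf_greatest) (auto simp: F_vertex)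
  then show ?thesis using uv by (simp add: mdist_X)
qed

text \<open>
  Writing \<open>h\<close> as a word in the generators gives a bound that is the same for all \<open>g\<close>.
\<close>

lemma mdist_right_translate_bounded:
  assumes "h \<in> carrier G"
  shows "\<exists>l. \<forall>g\<in>carrier G. mdist X (vertex g) (vertex (g \<otimes> h)) \<le> l"
proof -
  have S: "S \<subseteq> carrier G" and h: "h \<in> generate G S"
    using generating assms by (auto simp: finite_generating_set_def)
  have edge: "mdist X (vertex g) (vertex k) \<le> 1"
    if "g \<in> carrier G" "k \<in> carrier G" "s \<in> S" "k = g \<otimes> s \<or> g = k \<otimes> s" for g k s
  proof (cases "g = k")
    case False
    then have "cayley_edge G S g k" using that unfolding cayley_edge_def by blast
    from mdist_le_chain[OF graph_chain_step1[of "cayley_edge G S" g k 0 1, OF this]]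
    show ?thesis by simp
  qed (use that in simp)
  show ?thesis
    using h
  proof (induction rule: generate.induct)
    case one
    show ?case by (intro exI[of _ 0]) simp
  next
    case (incl h)
    then show ?case using S by (intro exI[of _ 1] ballI edge[of _ _ h]) auto
  next
    case (inv h)
    then have "h \<in> carrier G" using S by auto
    then show ?case
      using inv by (intro exI[of _ 1] ballI edge[of _ _ h]) (auto simp: m_assoc)
  next
    case (eng h1 h2)
    then have c: "h1 \<in> carrier G" "h2 \<in> carrier G"
      using S generate_in_carrier by auto
    obtain l m where lm: "\<And>g. g \<in> carrier G \<Longrightarrow> mdist X (vertex g) (vertex (g \<otimes> h1)) \<le> l"
      "\<And>g. g \<in> carrier G \<Longrightarrow> mdist X (vertex g) (vertex (g \<otimes> h2)) \<le> m"
      using eng.IH by blast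
    have "mdist X (vertex g) (vertex (g \<otimes> (h1 \<otimes> h2))) \<le> l + m" if g: "g \<in> carrier G" for g
    proof -
      have "mdist X (vertex g) (vertex (g \<otimes> (h1 \<otimes> h2)))
          \<le> mdist X (vertex g) (vertex (g \<otimes> h1)) + mdist X (vertex (g \<otimes> h1)) (vertex (g \<otimes> (h1 \<otimes> h2)))"
        using g c by (intro mdist_triangle) auto
      then show ?thesis using lm(1)[OF g] lm(2)[of "g \<otimes> h1"] g c by (simp add: m_assoc)
    qed
    then show ?case by blast
  qed
qed

lemma near_vertex:
  assumes "x \<in> mspace X"
  shows "\<exists>u\<in>carrier G. mdist X x (vertex u) \<le> 1"
proof -
  consider u where "u \<in> carrier G" "x = vertex u"
    | u v t where "cayley_edge G S u v" "0 \<le> t" "t \<le> 1" "x = edge_point u v t"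
    using assms by (auto simp: mspace_X graph_points_def)
  then show ?thesis
  proof cases
    case 1
    then show ?thesis by (intro bexI[of _ u]) auto
  next
    case 2
    then have "mdist X x (vertex u) \<le> t"
      using mdist_le_chain[OF graph_chain_step1[of "cayley_edge G S" u v t 0]] by auto
    then show ?thesis using 2 by (intro bexI[of _ u]) (auto simp: cayley_edge_def)
  qed
qed

end

text \<open>
  The distance to \<open>u\<close> in the graph for \<open>T\<close>, divided by the maximal \<open>T\<close>-length \<open>\<Lambda>\<close> of the finitely
  many elements of \<open>S\<close>, changes by at most 1 along the edges of the graph for \<open>S\<close>, so it is a lower
  bound for the distance to \<open>u\<close> there.
\<close>

lemma cayley_vertices_lipschitz:
  assumes "group G" "finite_generating_set G S" "finite_generating_set G T"
  shows "\<exists>\<Lambda>\<ge>1. \<forall>u\<in>carrier G. \<forall>v\<in>carrier G.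
    mdist (cayley_graph G T) (vertex u) (vertex v) \<le> \<Lambda> * mdist (cayley_graph G S) (vertex u) (vertex v)"
proof -
  interpret group G by fact
  interpret S: cayley G S by unfold_locales fact
  interpret T: cayley G T by unfold_locales fact
  have fin: "finite S" and S: "S \<subseteq> carrier G"
    using assms(2) by (auto simp: finite_generating_set_def)
  have "\<forall>s\<in>S. \<exists>l. \<forall>g\<in>carrier G. mdist T.X (vertex g) (vertex (g \<otimes>\<^bsub>G\<^esub> s)) \<le> l"
    using T.mdist_right_translate_bounded S by blast
  from bchoice[OF this] obtain l where l: "\<And>s g. s \<in> S \<Longrightarrow> g \<in> carrier G \<Longrightarrow>
      mdist T.X (vertex g) (vertex (g \<otimes>\<^bsub>G\<^esub> s)) \<le> l s" by blast
  define \<Lambda> where "\<Lambda> = Max (insert 1 (l ` S))"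
  have l_le: "l s \<le> \<Lambda>" if "s \<in> S" for s
    using fin that by (auto simp: \<Lambda>_def)
  have \<Lambda>1: "1 \<le> \<Lambda>" using fin by (auto simp: \<Lambda>_def)
  have edge: "mdist T.X (vertex g) (vertex h) \<le> \<Lambda>" if gh: "cayley_edge G S g h" for g h
  proof -
    obtain s where s: "s \<in> S" "h = g \<otimes>\<^bsub>G\<^esub> s \<or> g = h \<otimes>\<^bsub>G\<^esub> s" "g \<in> carrier G" "h \<in> carrier G"
      using gh unfolding cayley_edge_def by blast
    from s(2) have "mdist T.X (vertex g) (vertex h) \<le> l s"
    proof
      assume "h = g \<otimes>\<^bsub>G\<^esub> s"
      then show ?thesis using l[OF s(1,3)] by simp
    next
      assume "g = h \<otimes>\<^bsub>G\<^esub> s"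
      then show ?thesis
        using l[OF s(1,4)] unfolding mdist_commute[of T.X "vertex g" "vertex h"] by simp
    qed
    then show ?thesis using l_le[OF s(1)] by linarith
  qed
  have "mdist T.X (vertex u) (vertex v) \<le> \<Lambda> * mdist S.X (vertex u) (vertex v)"
    if uv: "u \<in> carrier G" "v \<in> carrier G" for u v
  proof -
    define D where "D w = mdist T.X (vertex u) (vertex w) / \<Lambda>" for w
    have "\<bar>D g - D h\<bar> \<le> 1" if "cayley_edge G S g h" for g h
    proof -
      have gh: "vertex g \<in> mspace T.X" "vertex h \<in> mspace T.X" "vertex u \<in> mspace T.X"
        using that uv by (auto simp: cayley_edge_def)
      have "\<bar>mdist T.X (vertex u) (vertex g) - mdist T.X (vertex u) (vertex h)\<bar> \<le> \<Lambda>"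
        using mdist_triangle[OF gh(3,1,2)] mdist_triangle[OF gh(3,2,1)] edge[OF that]
          mdist_commute[of T.X "vertex g" "vertex h"] by linarith
      moreover have "\<bar>D g - D h\<bar>
          = \<bar>mdist T.X (vertex u) (vertex g) - mdist T.X (vertex u) (vertex h)\<bar> / \<Lambda>"
        using \<Lambda>1 by (simp add: D_def diff_divide_distrib[symmetric] abs_divide)
      ultimately show ?thesis using \<Lambda>1 by simp
    qed
    then have "\<bar>D u - D v\<bar> \<le> mdist S.X (vertex u) (vertex v)"
      using S.abs_diff_le_mdist_vertices[of D, OF _ uv] by blast
    then have "mdist T.X (vertex u) (vertex v) / \<Lambda> \<le> mdist S.X (vertex u) (vertex v)"
      using uv \<Lambda>1 by (simp add: D_def)
    then show ?thesis using \<Lambda>1 by (simp add: pos_divide_le_eq mult.commute)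
  qed
  with \<Lambda>1 show ?thesis by blast
qed

text \<open>
  The quasi-isometry rounds a point to a vertex at distance at most 1.  It has to fix the vertices,
  so that it maps the copy of \<open>H\<close> in one graph onto its copy in the other.
\<close>

lemma morse_subset_change_generators:
  assumes G: "group G" and S: "finite_generating_set G S" and T: "finite_generating_set G T"
    and H: "H \<subseteq> carrier G" "H \<noteq> {}" and morse: "morse_subset (cayley_graph G T) (vertex ` H)"
  shows "morse_subset (cayley_graph G S) (vertex ` H)"
proof -
  interpret group G by fact
  interpret S: cayley G S by unfold_locales fact
  interpret T: cayley G T by unfold_locales fact
  obtain \<Lambda>1 where \<Lambda>1: "1 \<le> \<Lambda>1" "\<And>u v. u \<in> carrier G \<Longrightarrow> v \<in> carrier G \<Longrightarrow>
      mdist T.X (vertex u) (vertex v) \<le> \<Lambda>1 * mdist S.X (vertex u) (vertex v)"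
    using cayley_vertices_lipschitz[OF G S T] by blast
  obtain \<Lambda>2 where \<Lambda>2: "1 \<le> \<Lambda>2" "\<And>u v. u \<in> carrier G \<Longrightarrow> v \<in> carrier G \<Longrightarrow>
      mdist S.X (vertex u) (vertex v) \<le> \<Lambda>2 * mdist T.X (vertex u) (vertex v)"
    using cayley_vertices_lipschitz[OF G T S] by blast
  define \<Lambda> where "\<Lambda> = max \<Lambda>1 \<Lambda>2"
  have \<Lambda>: "1 \<le> \<Lambda>" using \<Lambda>1 by (simp add: \<Lambda>_def)
  have TS: "mdist T.X (vertex u) (vertex v) \<le> \<Lambda> * mdist S.X (vertex u) (vertex v)"
    and ST: "mdist S.X (vertex u) (vertex v) \<le> \<Lambda> * mdist T.X (vertex u) (vertex v)"
    if "u \<in> carrier G" "v \<in> carrier G" for u v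
    using \<Lambda>1(2)[OF that] \<Lambda>2(2)[OF that] mult_right_mono[of \<Lambda>1 \<Lambda> "mdist S.X (vertex u) (vertex v)"]
      mult_right_mono[of \<Lambda>2 \<Lambda> "mdist T.X (vertex u) (vertex v)"] by (auto simp: \<Lambda>_def)
  have "\<exists>u. u \<in> carrier G \<and> mdist S.X x (vertex u) \<le> 1 \<and> (x \<in> vertex ` carrier G \<longrightarrow> x = vertex u)"
    if "x \<in> mspace S.X" for x
  proof (cases "x \<in> vertex ` carrier G")
    case True
    then obtain u where "u \<in> carrier G" "x = vertex u" by blast
    then show ?thesis by (intro exI[of _ u]) auto
  next
    case False
    then show ?thesis using S.near_vertex[OF that] by blast
  qed
  then have "\<forall>x\<in>mspace S.X. \<exists>u. u \<in> carrier G \<and> mdist S.X x (vertex u) \<le> 1 \<and>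
      (x \<in> vertex ` carrier G \<longrightarrow> x = vertex u)" by blast
  from bchoice[OF this] obtain \<phi> where \<phi>: "\<And>x. x \<in> mspace S.X \<Longrightarrow> \<phi> x \<in> carrier G"
    "\<And>x. x \<in> mspace S.X \<Longrightarrow> mdist S.X x (vertex (\<phi> x)) \<le> 1"
    "\<And>x. x \<in> mspace S.X \<Longrightarrow> x \<in> vertex ` carrier G \<Longrightarrow> x = vertex (\<phi> x)" by blast
  define f where "f x = vertex (\<phi> x)" for x
  have rounding: "\<bar>mdist S.X x y - mdist S.X (f x) (f y)\<bar> \<le> 2"
    if "x \<in> mspace S.X" "y \<in> mspace S.X" for x y
  proof -
    have in_S: "f x \<in> mspace S.X" "f y \<in> mspace S.X" using \<phi>(1) that by (auto simp: f_def)
    have near: "mdist S.X x (f x) \<le> 1" "mdist S.X y (f y) \<le> 1"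
      using \<phi>(2) that by (auto simp: f_def)
    show ?thesis
      using mdist_triangle[OF that(1) in_S(1) that(2)] mdist_triangle[OF in_S that(2)]
        mdist_triangle[OF in_S(1) that(1) in_S(2)] mdist_triangle[OF that in_S(2)]
        near mdist_commute[of S.X x "f x"] mdist_commute[of S.X y "f y"]
      by linarith
  qed
  have f_H: "f ` vertex ` H = vertex ` H"
  proof -
    have "f (vertex h) = vertex h" if "h \<in> H" for h
      using \<phi>(3)[of "vertex h"] that H S.vertex_in by (auto simp: f_def)
    then show ?thesis by (auto simp: image_image)
  qed
  show ?thesis
  proof (rule morse_subset_quasi_isometric_pullback[where f = f and Y = T.X and \<Lambda> = \<Lambda> and B = "2 * \<Lambda>"])
    show "f x \<in> mspace T.X" if "x \<in> mspace S.X" for x using \<phi>(1)[OF that] by (simp add: f_def)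
    show "vertex ` H \<subseteq> mspace S.X" "vertex ` H \<noteq> {}" using H by auto
    show "morse_subset T.X (f ` vertex ` H)" using morse by (simp add: f_H)
    fix x y assume xy: "x \<in> mspace S.X" "y \<in> mspace S.X"
    show "mdist S.X x y \<le> \<Lambda> * mdist T.X (f x) (f y) + 2 * \<Lambda>"
      using rounding[OF xy] ST[OF \<phi>(1) \<phi>(1), OF xy] \<Lambda> unfolding f_def by linarith
    have "\<Lambda> * mdist S.X (f x) (f y) \<le> \<Lambda> * (mdist S.X x y + 2)"
      using rounding[OF xy] \<Lambda> by (intro mult_left_mono) auto
    then show "mdist T.X (f x) (f y) \<le> \<Lambda> * mdist S.X x y + 2 * \<Lambda>"
      using TS[OF \<phi>(1) \<phi>(1), OF xy] unfolding f_def by (simp add: algebra_simps)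
  qed (use \<Lambda> in auto)
qed

lemma strongly_quasiconvex_iff_morse_subset:
  assumes "group G" "finite_generating_set G S" "H \<subseteq> carrier G" "H \<noteq> {}"
  shows "strongly_quasiconvex G H \<longleftrightarrow> morse_subset (cayley_graph G S) (vertex ` H)"
proof
  assume "strongly_quasiconvex G H"
  then obtain T where "finite_generating_set G T" "morse_subset (cayley_graph G T) (vertex ` H)"
    unfolding strongly_quasiconvex_def morse_subset_def by blast
  then show "morse_subset (cayley_graph G S) (vertex ` H)"
    using morse_subset_change_generators[OF assms(1,2) _ assms(3,4)] by blast
next
  assume "morse_subset (cayley_graph G S) (vertex ` H)"
  then show "strongly_quasiconvex G H"
    unfolding strongly_quasiconvex_def morse_subset_def using assms(2) by blast
qed

section \<open>Strong quasiconvexity and divergence of subgroups\<close>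

theorem theorem1p5:
  fixes G :: "('a, 'b) monoid_scheme" and S H :: "'a set"
  assumes "group G" and "finite_generating_set G S"
    and "subgroup H G" and "infinite H"
  shows "strongly_quasiconvex G H \<longleftrightarrow>
         completely_super_linear_family (group_lower_rel_div G S H)"
proof -
  have H: "H \<subseteq> carrier G" "H \<noteq> {}"
    using assms(3) subgroup.subset subgroup.one_closed by blast+
  interpret group G by fact
  interpret cayley G S by unfold_locales fact
  interpret length_space_subset X "vertex ` H"
    using H by (rule length_space_subset_vertices)
  show ?thesis
    unfolding strongly_quasiconvex_iff_morse_subset[OF assms(1,2) H] group_lower_rel_div_def
      completely_super_linear_family_def
  proof
    assume "morse_subset X (vertex ` H)"
    then show "\<exists>n0\<ge>3. \<forall>\<rho>. 0 < \<rho> \<and> \<rho> \<le> 1 \<longrightarrow>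
        completely_super_linear (lower_rel_div X (vertex ` H) n0 \<rho>)"
      using completely_super_linear_of_morse_subset by blast
  next
    assume "\<exists>n0\<ge>3. \<forall>\<rho>. 0 < \<rho> \<and> \<rho> \<le> 1 \<longrightarrow>
        completely_super_linear (lower_rel_div X (vertex ` H) n0 \<rho>)"
    then obtain n0 where "completely_super_linear (lower_rel_div X (vertex ` H) n0 1)"
      using zero_less_one order_refl by blast
    then show "morse_subset X (vertex ` H)"
      by (rule morse_subset_of_completely_super_linear)
  qed
qed

end
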